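(* Let $w$ be a cyclically reduced word in the letters $g_1,g_1^{-1},\ldots,g_k,g_k^{-1}$ such that the element of the group $F_k/[g_1^{d_1},\ldots,g_k^{d_k}]$ represented by $w$ has finite order $d\geq1$, and let $\sigma_n=w(s_1(n),\ldots,s_k(n))$. Then, as $n$ goes to infinity (along integers $n$ such that $\mathfrak{S}_n(A_r)\neq\emptyset$ for all $r\in[k]$), for all $p\in[1,+\infty)$, $N_d(\sigma_n)/n$ converges to $1/d$ in $L^p$, and for all $l\neq d$, $N_l(\sigma_n)/n$ converges to $0$ in $L^p$.
   Context: Notation: $[n]=\{1,\ldots,n\}$; $\mathfrak{S}_n$ is the group of permutations of $[n]$; for a set $A$ of positive integers, $\mathfrak{S}_n(A)$ is the set of permutations of $[n]$ all of whose cycles have length in $A$; for a permutation $\sigma$ and $l\ge 1$, $N_l(\sigma)$ is the number of cycles of length $l$ of $\sigma$ (fixed points are cycles of length 1). Random permutations. Fix $k\ge1$ and nonempty sets $A_1,\ldots,A_k$ of positive integers, none of them equal to $\{1\}$, such that each $A_i$ is either finite or satisfies $\sum_{j\geq1,\,j\notin A_i}\frac1j<\infty$. Put $d_i=\sup A_i\in\{2,3,\ldots\}\cup\{\infty\}$. For $n$ such that $\mathfrak{S}_n(A_1),\ldots,\mathfrak{S}_n(A_k)$ are all nonempty, $s_1(n),\ldots,s_k(n)$ are independent random permutations, $s_i(n)$ being uniformly distributed on $\mathfrak{S}_n(A_i)$. For a word $w$, $w(s_1(n),\ldots,s_k(n))$ is the permutation obtained by replacing each letter $g_i^{\pm1}$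 of $w$ by $s_i(n)^{\pm1}$ and composing. Words. A word in the letters $g_1,g_1^{-1},\ldots,g_k,g_k^{-1}$ is reduced if no letter is followed by its inverse, and cyclically reduced if moreover its first and last letters are not inverses of each other. $F_k$ is the free group on $g_1,\ldots,g_k$, and $F_k/[g_1^{d_1},\ldots,g_k^{d_k}]$ is its quotient by the normal subgroup generated by $\{g_i^{d_i} : i\in[k], d_i<\infty\}$. *)

theory Defs
  imports
    "HOL-Probability.Probability"
    "HOL-Algebra.Multiplicative_Group"
    "HOL-Combinatorics.Orbits"
begin

section \<open>Words and the free group\<close>

text \<open>The letter \<^term>\<open>(i, True)\<close> stands for $g_i$ and \<^term>\<open>(i, False)\<close> for $g_i^{-1}$.\<close>

type_synonym letter = "nat \<times> bool"
type_synonym gen_word = "letter list"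

definition inv_letter :: "letter \<Rightarrow> letter" where
  "inv_letter a = (fst a, \<not> snd a)"

definition words_over :: "nat \<Rightarrow> gen_word set" where
  "words_over k = {w. fst ` set w \<subseteq> {1..k}}"

definition reduced_word :: "gen_word \<Rightarrow> bool" where
  "reduced_word w \<longleftrightarrow> (\<forall>j. Suc j < length w \<longrightarrow> w ! Suc j \<noteq> inv_letter (w ! j))"

text \<open>The empty word counts as cyclically reduced.\<close>

definition cyclically_reduced :: "gen_word \<Rightarrow> bool" where
  "cyclically_reduced w \<longleftrightarrow> reduced_word w \<and> (w \<noteq> [] \<longrightarrow> last w \<noteq> inv_letter (hd w))"

fun push_letter :: "letter \<Rightarrow> gen_word \<Rightarrow> gen_word" where
  "push_letter a [] = [a]"
| "push_letter a (b # w) = (if b = inv_letter a then w else a # b # w)"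

definition reduce_word :: "gen_word \<Rightarrow> gen_word" where
  "reduce_word w = foldr push_letter w []"

text \<open>The free group on $g_1, \dots, g_k$, realised on the reduced words: the product of two
  reduced words is the reduced form of their concatenation.\<close>

definition free_group :: "nat \<Rightarrow> gen_word monoid" where
  "free_group k = \<lparr>carrier = {w \<in> words_over k. reduced_word w},
     mult = (\<lambda>u v. reduce_word (u @ v)), one = []\<rparr>"

definition normal_closure :: "('a, 'b) monoid_scheme \<Rightarrow> 'a set \<Rightarrow> 'a set" where
  "normal_closure G R = \<Inter> {N. N \<lhd> G \<and> R \<subseteq> N}"

text \<open>The relators $g_i^{d_i}$, for those \<^term>\<open>i\<close> such that $d_i = \sup A_i$ is finite.\<close>

definition power_relators :: "nat \<Rightarrow> (nat \<Rightarrow> nat set) \<Rightarrow> gen_word set" where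
  "power_relators k A =
     {[(i, True)] [^]\<^bsub>free_group k\<^esub> m | i m. i \<in> {1..k} \<and> (SUP a\<in>A i. enat a) = enat m}"

definition relator_subgroup :: "nat \<Rightarrow> (nat \<Rightarrow> nat set) \<Rightarrow> gen_word set" where
  "relator_subgroup k A = normal_closure (free_group k) (power_relators k A)"

definition quotient_group :: "nat \<Rightarrow> (nat \<Rightarrow> nat set) \<Rightarrow> gen_word set monoid" where
  "quotient_group k A = free_group k Mod relator_subgroup k A"

definition word_class :: "nat \<Rightarrow> (nat \<Rightarrow> nat set) \<Rightarrow> gen_word \<Rightarrow> gen_word set" where
  "word_class k A w = relator_subgroup k A #>\<^bsub>free_group k\<^esub> w"

lemma free_group_is_group: "group (free_group k)"
proof -
  have inv_inv [simp]: "inv_letter (inv_letter a) = a" and fst_inv [simp]: "fst (inv_letter a) = fst a"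
    for a by (simp_all add: inv_letter_def)
  have red_Cons: "reduced_word (a # w) \<longleftrightarrow> reduced_word w \<and> (w \<noteq> [] \<longrightarrow> hd w \<noteq> inv_letter a)" for a w
    by (cases w) (auto simp: reduced_word_def nth_Cons split: nat.splits)
  have red_Nil [simp]: "reduced_word []"
    by (simp add: reduced_word_def)
  have push_red: "reduced_word (push_letter a w)" if "reduced_word w" for a w
    using that by (cases w) (auto simp: red_Cons)
  have fold_red: "reduced_word (foldr push_letter u w)" if "reduced_word w" for u w
    using that by (induction u) (auto simp: push_red)
  have push_over: "push_letter a w \<in> words_over k" if "fst a \<in> {1..k}" "w \<in> words_over k" for a w
    using that by (cases w) (auto simp: words_over_def)
  have fold_over: "foldr push_letter u w \<in> words_over k"
    if "u \<in> words_over k" "w \<in> words_over k" for u w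
    using that(1)
  proof (induction u)
    case (Cons a u)
    then show ?case using push_over[of a "foldr push_letter u w"] by (simp add: words_over_def)
  qed (use that in simp)
  have nil_over: "[] \<in> words_over k"
    by (simp add: words_over_def)
  have push_push: "push_letter (inv_letter a) (push_letter a w) = w" if "reduced_word w" for a w
    using that
  proof (cases w)
    case (Cons b v)
    then show ?thesis using that by (cases v) (auto simp: red_Cons)
  qed simp
  have fold_push: "foldr push_letter (push_letter a u) w = push_letter a (foldr push_letter u w)"
    if "reduced_word w" for a u w
  proof (cases u)
    case (Cons b v)
    show ?thesis
    proof (cases "b = inv_letter a")
      case True
      then show ?thesis
        using Cons push_push[OF fold_red[OF that], of "inv_letter a" v] by simp
    qed (use Cons in simp)
  qed simp
  have fold_fold: "foldr push_letter (foldr push_letter u v) w = foldr push_letter u (foldr push_letter v w)"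
    if "reduced_word w" for u v w
    by (induction u) (simp_all add: fold_push that)
  have red_id: "foldr push_letter w [] = w" if "reduced_word w" for w
    using that
  proof (induction w)
    case (Cons a w)
    then show ?case by (cases w) (auto simp: red_Cons)
  qed simp
  have mult: "u \<otimes>\<^bsub>free_group k\<^esub> v = foldr push_letter u v" if "reduced_word v" for u v
    using that by (simp add: free_group_def reduce_word_def red_id)
  have carr: "w \<in> carrier (free_group k) \<longleftrightarrow> w \<in> words_over k \<and> reduced_word w" for w
    by (simp add: free_group_def)
  have one: "\<one>\<^bsub>free_group k\<^esub> = []"
    by (simp add: free_group_def)
  have linv: "foldr push_letter (rev (map inv_letter w)) w = []" if "reduced_word w" for w
    using that
  proof (induction w)
    case (Cons a w)
    then show ?case by (simp add: red_Cons)
  qed simp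
  show ?thesis
  proof (rule groupI)
    fix x assume x: "x \<in> carrier (free_group k)"
    define y where "y = foldr push_letter (rev (map inv_letter x)) []"
    have y: "y \<in> carrier (free_group k)"
      unfolding y_def carr using x
      by (auto intro!: fold_red fold_over simp: carr) (auto simp: words_over_def)
    have "y \<otimes>\<^bsub>free_group k\<^esub> x = \<one>\<^bsub>free_group k\<^esub>"
      using x by (simp add: y_def carr mult one fold_fold linv)
    with y show "\<exists>y\<in>carrier (free_group k). y \<otimes>\<^bsub>free_group k\<^esub> x = \<one>\<^bsub>free_group k\<^esub>" by blast
  qed (auto simp: carr mult one fold_red fold_fold intro: nil_over fold_over)
qed

section \<open>Permutations with restricted cycle lengths\<close>

text \<open>The supports of the cycles of a permutation of $[n]$, fixed points included.\<close>

definition cycle_supports :: "nat \<Rightarrow> (nat \<Rightarrow> nat) \<Rightarrow> nat set set" where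
  "cycle_supports n \<sigma> = orbit \<sigma> ` {1..n}"

definition num_cycles :: "nat \<Rightarrow> nat \<Rightarrow> (nat \<Rightarrow> nat) \<Rightarrow> nat" where
  "num_cycles n l \<sigma> = card {C \<in> cycle_supports n \<sigma>. card C = l}"

definition restricted_perms :: "nat \<Rightarrow> nat set \<Rightarrow> (nat \<Rightarrow> nat) set" where
  "restricted_perms n A = {\<sigma>. \<sigma> permutes {1..n} \<and> (\<forall>C\<in>cycle_supports n \<sigma>. card C \<in> A)}"

definition eval_letter :: "(nat \<Rightarrow> nat \<Rightarrow> nat) \<Rightarrow> letter \<Rightarrow> nat \<Rightarrow> nat" where
  "eval_letter s a = (if snd a then s (fst a) else inv_into UNIV (s (fst a)))"

definition eval_word :: "(nat \<Rightarrow> nat \<Rightarrow> nat) \<Rightarrow> gen_word \<Rightarrow> nat \<Rightarrow> nat" where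
  "eval_word s w = foldr (\<lambda>a \<tau>. eval_letter s a \<circ> \<tau>) w id"

section \<open>Convergence\<close>

definition admissible :: "nat \<Rightarrow> (nat \<Rightarrow> nat set) \<Rightarrow> nat set" where
  "admissible k A = {n. \<forall>r\<in>{1..k}. restricted_perms n (A r) \<noteq> {}}"

definition admissible_filter :: "nat \<Rightarrow> (nat \<Rightarrow> nat set) \<Rightarrow> nat filter" where
  "admissible_filter k A = inf sequentially (principal (admissible k A))"

text \<open>Convergence in $L^p$ of \<^term>\<open>X n\<close> to the constant \<^term>\<open>c\<close>. Each \<^term>\<open>X n\<close> may live on its own
  probability space \<^term>\<open>M n\<close>.\<close>

definition converges_in_Lp ::
  "real \<Rightarrow> (nat \<Rightarrow> 'a measure) \<Rightarrow> (nat \<Rightarrow> 'a \<Rightarrow> real) \<Rightarrow> real \<Rightarrow> nat filter \<Rightarrow> bool" where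
  "converges_in_Lp p M X c F \<longleftrightarrow>
     (\<forall>\<^sub>F n in F. X n \<in> borel_measurable (M n) \<and> integrable (M n) (\<lambda>\<omega>. \<bar>X n \<omega>\<bar> powr p)) \<and>
     ((\<lambda>n. \<integral>\<omega>. \<bar>X n \<omega> - c\<bar> powr p \<partial>M n) \<longlongrightarrow> 0) F"

end

theory Submission
  imports Defs "HOL-Combinatorics.Cycles" "HOL-Real_Asymp.Real_Asymp"
begin

text \<open>Write n points as vertices and let an edge labelled i go from x to s_i(x). Seen from a uniformly
  chosen point, the graph looks like the Cayley graph of the free product of the cyclic groups of
  order d_i: a typical cycle of s_i has length d_i if d_i is finite and is long otherwise. So, for
  almost every point x, w(s) fixes x exactly if w is trivial in the quotient of F_k by the g_i^{d_i},
  and the orbit of x under w(s) has as many points as the order d of w. As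
  l N_l counts the points in cycles of length l, N_d / n then tends to 1/d and the other N_l / n
  to 0 in mean; all these quantities lie in [0, 1], so convergence in L^1 gives convergence in L^p.
  
  "Almost every point" is made precise by the predicate negligible: a property of a tuple s and a point
  x is negligible if the expected proportion of the points x that have it tends to 0. Three facts carry the proof.
  
  \<^item> If l < d both lie in A_i, lying in a cycle of length l of s_i is negligible
    (negligible_cycle_length). The mean number of points in l-cycles of a uniform element of
    S_n(A) is a(n - l) / a(n), where a(n) = |S_n(A)| / n!. Variance being nonnegative, this ratio
    drops by at most l when n decreases by l; if it were at least of order n, the telescoping product
    a(n - l d) / a(n) of d such ratios would be of order n^d. But a(n - d) \<le> n a(n)
    bounds the same quantity by n^l.
  
  \<^item> If consecutive syllables g_i^e of a word use different generators and each syllable by itself fixes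
    only a negligible set of points, the word fixes only a negligible set of points
    (negligible_fixed_run). A shortest loop in the path of a fixed point that is not a single
    syllable can be opened by conjugating one s_i by a transposition of its base point with any point z off
    the loop; the path from the base point then ends at z, so that the new tuple and the base point determine both z and
    the old tuple. Hence such loops occur for at most about a fraction 1/n of all pairs of a tuple and a base point.
  
  \<^item> Deleting subwords a a^{-1} and a^{d_i} changes the word only at negligibly many points, and the
    words where nothing can be deleted are empty or of the kind just described. Hence a word outside the
    relator subgroup fixes a negligible set of points (negligible_fixed_points). A word inside it
    moves a negligible set of points, because the words that do so form a normal subgroup
    (negligible_moved_points).\<close>

section \<open>Splitting off the cycle of a point\<close>

lemma card_orbit_eq_least_power:
  assumes "permutation \<sigma>"
  shows "card (orbit \<sigma> x) = least_power \<sigma> x"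
proof -
  have "orbit \<sigma> x = set (support \<sigma> x)"
    unfolding support_set[OF assms] orbit_altdef_permutation[OF assms] by auto
  then show ?thesis
    using distinct_card[OF cycle_of_permutation[OF assms, of x]] by simp
qed

lemma funpow_fixes_iff_card_orbit_dvd:
  assumes "permutation \<sigma>"
  shows "(\<sigma> ^^ m) x = x \<longleftrightarrow> card (orbit \<sigma> x) dvd m"
  by (simp add: assms card_orbit_eq_least_power least_power_dvd)

definition perms_with :: "'a set \<Rightarrow> nat set \<Rightarrow> ('a \<Rightarrow> 'a) set" where
  "perms_with S A = {\<sigma>. \<sigma> permutes S \<and> (\<forall>x\<in>S. card (orbit \<sigma> x) \<in> A)}"

lemma restricted_perms_eq: "restricted_perms n A = perms_with {1..n} A"
  by (auto simp: restricted_perms_def perms_with_def cycle_supports_def)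

lemma finite_perms_with [simp]: "finite S \<Longrightarrow> finite (perms_with S A)"
  by (rule finite_subset[OF _ finite_permutations[of S]]) (auto simp: perms_with_def)

text \<open>A cycle through x, written as the list that starts at x, so that each cycle occurs once.\<close>

definition rooted_cycles :: "'a set \<Rightarrow> 'a \<Rightarrow> nat \<Rightarrow> 'a list set" where
  "rooted_cycles S x l = {xs. distinct xs \<and> set xs \<subseteq> S \<and> length xs = l \<and> xs \<noteq> [] \<and> hd xs = x}"

lemma card_rooted_cycles:
  assumes "finite S" "x \<in> S" "1 \<le> l" "l \<le> card S"
  shows "card (rooted_cycles S x l) * fact (card S - l) = (fact (card S - 1) :: nat)"
proof -
  let ?L = "{ys. length ys = l - 1 \<and> distinct ys \<and> set ys \<subseteq> S - {x}}"
  have "rooted_cycles S x l = (\<lambda>ys. x # ys) ` ?L"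
  proof (intro equalityI subsetI)
    fix xs assume "xs \<in> rooted_cycles S x l"
    then show "xs \<in> (\<lambda>ys. x # ys) ` ?L"
      by (cases xs) (auto simp: rooted_cycles_def)
  qed (use assms in \<open>auto simp: rooted_cycles_def\<close>)
  then have "card (rooted_cycles S x l) = card ?L"
    by (simp add: card_image)
  also have "\<dots> = \<Prod>{card (S - {x}) - (l - 1) + 1..card (S - {x})}"
    by (rule card_lists_distinct_length_eq) (use assms in auto)
  also have "{card (S - {x}) - (l - 1) + 1..card (S - {x})} = {card S - l + 1..card S - 1}"
    using assms by auto
  finally have "card (rooted_cycles S x l) * fact (card S - l)
      = \<Prod>{1..card S - l} * \<Prod>{card S - l + 1..card S - 1}"
    by (simp add: fact_prod)
  also have "\<dots> = \<Prod>({1..card S - l} \<union> {card S - l + 1..card S - 1})"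
    by (rule prod.union_disjoint[symmetric]) auto
  also have "{1..card S - l} \<union> {card S - l + 1..card S - 1} = {1..card S - 1}"
    using assms by auto
  finally show ?thesis by (simp add: fact_prod)
qed

lemma cycle_of_list_funpow_hd:
  assumes "distinct xs" "xs \<noteq> []"
  shows "(cycle_of_list xs ^^ m) (hd xs) = xs ! (m mod length xs)"
proof -
  have "(cycle_of_list xs ^^ m) (hd xs) = map (cycle_of_list xs ^^ m) xs ! 0"
    using assms by (cases xs) auto
  also have "\<dots> = rotate m xs ! 0"
    using cyclic_rotation[OF assms(1)] by simp
  also have "\<dots> = xs ! (m mod length xs)"
    using assms by (simp add: nth_rotate)
  finally show ?thesis .
qed

lemma orbit_cycle_of_list:
  assumes "distinct xs" "y \<in> set xs"
  shows "orbit (cycle_of_list xs) y = set xs"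
proof -
  have ne: "xs \<noteq> []" using assms by auto
  have perm: "permutation (cycle_of_list xs)" by (rule permutation_of_cycle)
  have "orbit (cycle_of_list xs) (hd xs) = {xs ! (m mod length xs) | m. True}"
    by (simp add: orbit_altdef_permutation[OF perm] cycle_of_list_funpow_hd assms ne)
  also have "\<dots> = set xs"
  proof (intro equalityI subsetI)
    fix z assume "z \<in> set xs"
    then obtain i where "i < length xs" "z = xs ! i" by (auto simp: in_set_conv_nth)
    then have "z = xs ! (i mod length xs)" by simp
    then show "z \<in> {xs ! (m mod length xs) | m. True}" by blast
  qed (use ne in auto)
  finally have "orbit (cycle_of_list xs) (hd xs) = set xs" .
  with cyclic_on_orbit'[OF perm, of "hd xs"] assms show ?thesis
    by (metis orbit_cyclic_eq3)
qed

context
  fixes S :: "'a set" and xs :: "'a list" and \<tau> :: "'a \<Rightarrow> 'a"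
  assumes dist: "distinct xs" and sub: "set xs \<subseteq> S"
    and perm: "\<tau> permutes S - set xs"
begin

lemma glue_on_cycle: "y \<in> set xs \<Longrightarrow> (cycle_of_list xs \<circ> \<tau>) y = cycle_of_list xs y"
  using perm by (simp add: permutes_not_in)

lemma glue_off_cycle: "y \<notin> set xs \<Longrightarrow> (cycle_of_list xs \<circ> \<tau>) y = \<tau> y"
  using permutes_in_image[OF perm, of y] permutes_not_in[OF perm, of y]
  by (cases "y \<in> S") (auto intro: id_outside_supp)

lemma glue_permutes: "cycle_of_list xs \<circ> \<tau> permutes S"
  using perm cycle_permutes[of xs] sub
  by (intro permutes_compose) (auto intro: permutes_subset)

lemma orbit_glue_on_cycle: "y \<in> set xs \<Longrightarrow> orbit (cycle_of_list xs \<circ> \<tau>) y = set xs"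
  using orbit_cong0[of y "set xs" "cycle_of_list xs \<circ> \<tau>" "cycle_of_list xs"] glue_on_cycle
    permutes_in_image[OF cycle_permutes[of xs]] orbit_cycle_of_list[OF dist, of y]
  by (simp add: Pi_iff del: o_apply)

lemma orbit_glue_off_cycle: "y \<in> S - set xs \<Longrightarrow> orbit (cycle_of_list xs \<circ> \<tau>) y = orbit \<tau> y"
  using glue_off_cycle permutes_in_image[OF perm]
  by (intro orbit_cong0[of _ "S - set xs"]) auto

end

text \<open>The recursive structure of permutations with restricted cycle lengths: remove the cycle of x,
  of length l, and what remains is an arbitrary such permutation of the other points.\<close>

lemma bij_betw_glue_cycle:
  assumes fin: "finite S" and x: "x \<in> S" and l: "l \<in> A"
  shows "bij_betw (\<lambda>(xs, \<tau>). cycle_of_list xs \<circ> \<tau>)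
           (SIGMA xs:rooted_cycles S x l. perms_with (S - set xs) A)
           {\<sigma> \<in> perms_with S A. card (orbit \<sigma> x) = l}"
proof (rule bij_betw_byWitness[where f' = "\<lambda>\<sigma>. (support \<sigma> x, perm_restrict \<sigma> (S - orbit \<sigma> x))"])
  let ?D = "SIGMA xs:rooted_cycles S x l. perms_with (S - set xs) A"
  let ?E = "{\<sigma> \<in> perms_with S A. card (orbit \<sigma> x) = l}"
  have glue: "cycle_of_list xs \<circ> \<tau> \<in> ?E" "support (cycle_of_list xs \<circ> \<tau>) x = xs"
      "perm_restrict (cycle_of_list xs \<circ> \<tau>) (S - orbit (cycle_of_list xs \<circ> \<tau>) x) = \<tau>"
    if "xs \<in> rooted_cycles S x l" "\<tau> \<in> perms_with (S - set xs) A" for xs \<tau>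
  proof -
    have h: "distinct xs" "set xs \<subseteq> S" "length xs = l" "xs \<noteq> []" "hd xs = x" "x \<in> set xs"
        "\<tau> permutes S - set xs" "\<And>y. y \<in> S - set xs \<Longrightarrow> card (orbit \<tau> y) \<in> A"
      using that by (auto simp: rooted_cycles_def perms_with_def)
    note g = h(1,2,7)
    let ?\<sigma> = "cycle_of_list xs \<circ> \<tau>"
    have cyc: "card (orbit ?\<sigma> y) = l" if "y \<in> set xs" for y
      using orbit_glue_on_cycle[OF g that] distinct_card[OF h(1)] h(3) by simp
    have off: "card (orbit ?\<sigma> y) \<in> A" if "y \<in> S - set xs" for y
      using orbit_glue_off_cycle[OF g that] h(8)[OF that] by simp
    have "card (orbit ?\<sigma> y) \<in> A" if "y \<in> S" for y
      using cyc[of y] off[of y] l that by (cases "y \<in> set xs") auto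
    then show "?\<sigma> \<in> ?E"
      using glue_permutes[OF g] cyc[OF h(6)] by (simp add: perms_with_def)
    have perm: "permutation ?\<sigma>"
      using glue_permutes[OF g] fin by (auto simp: permutation_permutes)
    have pow: "(?\<sigma> ^^ i) x = xs ! i" if "i < l" for i
    proof -
      have "(?\<sigma> ^^ i) x = (cycle_of_list xs ^^ i) x \<and> (?\<sigma> ^^ i) x \<in> set xs"
      proof (induction i)
        case (Suc i)
        then show ?case
          using glue_on_cycle[OF g] permutes_in_image[OF cycle_permutes[of xs]]
          by (metis comp_apply funpow.simps(2))
      qed (use h in simp)
      then show ?thesis
        using cycle_of_list_funpow_hd[OF h(1,4), of i] that h by simp
    qed
    have "least_power ?\<sigma> x = l"
      using cyc[OF h(6)] card_orbit_eq_least_power[OF perm] by simp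
    then show "support ?\<sigma> x = xs"
      using pow h(3) by (intro nth_equalityI) auto
    show "perm_restrict ?\<sigma> (S - orbit ?\<sigma> x) = \<tau>"
    proof
      fix y
      show "perm_restrict ?\<sigma> (S - orbit ?\<sigma> x) y = \<tau> y"
        using glue_off_cycle[OF g, of y] orbit_glue_on_cycle[OF g h(6)] h(7)
        by (cases "y \<in> S - set xs") (auto simp: perm_restrict_def permutes_not_in)
    qed
  qed
  show "\<forall>p\<in>?D. (\<lambda>\<sigma>. (support \<sigma> x, perm_restrict \<sigma> (S - orbit \<sigma> x))) ((\<lambda>(xs, \<tau>). cycle_of_list xs \<circ> \<tau>) p) = p"
    using glue by auto
  show "(\<lambda>(xs, \<tau>). cycle_of_list xs \<circ> \<tau>) ` ?D \<subseteq> ?E"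
    using glue(1) by auto
  have unglue: "cycle_of_list (support \<sigma> x) \<circ> perm_restrict \<sigma> (S - orbit \<sigma> x) = \<sigma>"
      "(support \<sigma> x, perm_restrict \<sigma> (S - orbit \<sigma> x)) \<in> ?D" if "\<sigma> \<in> ?E" for \<sigma>
  proof -
    have s: "\<sigma> permutes S" "\<And>y. y \<in> S \<Longrightarrow> card (orbit \<sigma> y) \<in> A" "card (orbit \<sigma> x) = l"
      using that by (auto simp: perms_with_def)
    have perm: "permutation \<sigma>"
      using s fin by (auto simp: permutation_permutes)
    have set: "set (support \<sigma> x) = orbit \<sigma> x"
      unfolding support_set[OF perm] orbit_altdef_permutation[OF perm] by auto
    have cyc: "cyclic_on \<sigma> (orbit \<sigma> x)"
      by (rule cyclic_on_orbit'[OF perm])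
    have inS: "orbit \<sigma> x \<subseteq> S"
      by (rule permutes_orbit_subset[OF s(1) x])
    have pr: "perm_restrict \<sigma> (S - orbit \<sigma> x) permutes (S - orbit \<sigma> x)"
      by (rule perm_restrict_diff_cyclic[OF s(1) cyc])
    show "cycle_of_list (support \<sigma> x) \<circ> perm_restrict \<sigma> (S - orbit \<sigma> x) = \<sigma>"
    proof
      fix y
      show "(cycle_of_list (support \<sigma> x) \<circ> perm_restrict \<sigma> (S - orbit \<sigma> x)) y = \<sigma> y"
      proof (cases "y \<in> orbit \<sigma> x")
        case True
        then show ?thesis
          using cycle_restrict[OF perm, of y x] set by (simp add: perm_restrict_def)
      next
        case False
        then have "\<sigma> y \<notin> orbit \<sigma> x"
          using cyclic_on_f_in[OF s(1) cyc] by blast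
        then have "cycle_of_list (support \<sigma> x) (\<sigma> y) = \<sigma> y" "cycle_of_list (support \<sigma> x) y = y"
          using False set by (metis id_outside_supp)+
        then show ?thesis
          using False s(1) by (cases "y \<in> S") (simp_all add: perm_restrict_def permutes_not_in)
      qed
    qed
    have "orbit (perm_restrict \<sigma> (S - orbit \<sigma> x)) y = orbit \<sigma> y" if "y \<in> S - orbit \<sigma> x" for y
    proof (rule orbit_cong0[OF that])
      show "perm_restrict \<sigma> (S - orbit \<sigma> x) \<in> S - orbit \<sigma> x \<rightarrow> S - orbit \<sigma> x"
        using permutes_in_image[OF pr] by blast
    qed (simp add: perm_restrict_def)
    then have "perm_restrict \<sigma> (S - orbit \<sigma> x) \<in> perms_with (S - orbit \<sigma> x) A"
      using pr s(2) by (auto simp: perms_with_def)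
    moreover have "support \<sigma> x \<in> rooted_cycles S x l"
    proof -
      have pos: "0 < least_power \<sigma> x" by (rule least_power_of_permutation(2)[OF perm])
      then have "support \<sigma> x \<noteq> []" "hd (support \<sigma> x) = x"
        by (simp_all add: hd_map)
      moreover have "length (support \<sigma> x) = l"
        using s(3) card_orbit_eq_least_power[OF perm, of x] by simp
      ultimately show ?thesis
        unfolding rooted_cycles_def mem_Collect_eq set
        using cycle_of_permutation[OF perm, of x] inS by (intro conjI)
    qed
    ultimately show "(support \<sigma> x, perm_restrict \<sigma> (S - orbit \<sigma> x)) \<in> ?D"
      using set by simp
  qed
  show "\<forall>\<sigma>\<in>?E. (\<lambda>(xs, \<tau>). cycle_of_list xs \<circ> \<tau>) (support \<sigma> x, perm_restrict \<sigma> (S - orbit \<sigma> x)) = \<sigma>"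
    using unglue(1) by simp
  show "(\<lambda>\<sigma>. (support \<sigma> x, perm_restrict \<sigma> (S - orbit \<sigma> x))) ` ?E \<subseteq> ?D"
    using unglue(2) by blast
qed


lemma card_perms_with_cycle_length:
  assumes fin: "finite S" and x: "x \<in> S" and l: "l \<in> A"
    and const: "\<And>T. T \<subseteq> S \<Longrightarrow> card T = card S - l \<Longrightarrow> card (perms_with T A) = c"
  shows "card {\<sigma> \<in> perms_with S A. card (orbit \<sigma> x) = l} = card (rooted_cycles S x l) * c"
proof -
  have "finite (rooted_cycles S x l)"
    by (rule finite_subset[OF _ finite_lists_length_eq[OF fin, of l]]) (auto simp: rooted_cycles_def)
  moreover have "card (perms_with (S - set xs) A) = c" if "xs \<in> rooted_cycles S x l" for xs
    using that fin by (intro const) (auto simp: rooted_cycles_def card_Diff_subset distinct_card)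
  ultimately show ?thesis
    using bij_betw_same_card[OF bij_betw_glue_cycle[OF fin x l]] fin by (simp add: card_SigmaI)
qed

lemma card_orbit_bounds:
  assumes "\<sigma> permutes S" "finite S" "x \<in> S"
  shows "1 \<le> card (orbit \<sigma> x)" "card (orbit \<sigma> x) \<le> card S"
proof -
  have sub: "orbit \<sigma> x \<subseteq> S" by (rule permutes_orbit_subset[OF assms(1,3)])
  then show "card (orbit \<sigma> x) \<le> card S" by (rule card_mono[OF assms(2)])
  show "1 \<le> card (orbit \<sigma> x)"
    using finite_subset[OF sub assms(2)] orbit_nonempty[of \<sigma> x] by (simp add: Suc_leI card_gt_0_iff)
qed

lemma card_perms_with_split:
  assumes "finite S" "x \<in> S"
  shows "card (perms_with S A) = (\<Sum>l\<in>A \<inter> {1..card S}. card {\<sigma> \<in> perms_with S A. card (orbit \<sigma> x) = l})"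
proof -
  have "perms_with S A = (\<Union>l\<in>A \<inter> {1..card S}. {\<sigma> \<in> perms_with S A. card (orbit \<sigma> x) = l})"
    using assms card_orbit_bounds[OF _ assms] by (auto simp: perms_with_def)
  then have "card (perms_with S A) = card (\<Union>l\<in>A \<inter> {1..card S}. {\<sigma> \<in> perms_with S A. card (orbit \<sigma> x) = l})"
    by simp
  also have "\<dots> = (\<Sum>l\<in>A \<inter> {1..card S}. card {\<sigma> \<in> perms_with S A. card (orbit \<sigma> x) = l})"
    using assms by (intro card_UN_disjoint) auto
  finally show ?thesis .
qed

text \<open>The count depends on the size of the set only. Summing over the length of the cycle of a point expresses it
  through smaller sets, so this follows by induction, without transporting permutations along a bijection.\<close>

lemma card_perms_with_cong:
  fixes S T :: "'a set"
  assumes "finite S" "finite T" "card S = card T"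
  shows "card (perms_with S A) = card (perms_with T A)"
  using assms
proof (induction "card S" arbitrary: S T rule: less_induct)
  case less
  show ?case
  proof (cases "S = {}")
    case False
    then obtain x y where x: "x \<in> S" and y: "y \<in> T"
      using less.prems by fastforce
    have "card {\<sigma> \<in> perms_with S A. card (orbit \<sigma> x) = l} = card {\<sigma> \<in> perms_with T A. card (orbit \<sigma> y) = l}"
      if l: "l \<in> A" "1 \<le> l" "l \<le> card S" for l
    proof -
      obtain R where R: "R \<subseteq> S" "card R = card S - l"
        by (rule obtain_subset_with_card_n[of "card S - l" S]) auto
      define c where "c = card (perms_with R A)"
      have eq: "card (perms_with U A) = c" if "finite U" "card U = card S - l" for U :: "'a set"
        unfolding c_def using less.hyps[of U R] R l that finite_subset[OF R(1) less.prems(1)] by simp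
      have "card (rooted_cycles S x l) * fact (card S - l) = card (rooted_cycles T y l) * fact (card S - l)"
        using card_rooted_cycles[of S x l] card_rooted_cycles[of T y l] less.prems x y l by simp
      then have "card (rooted_cycles S x l) = card (rooted_cycles T y l)" by simp
      moreover have "card {\<sigma> \<in> perms_with S A. card (orbit \<sigma> x) = l} = card (rooted_cycles S x l) * c"
        using less.prems by (intro card_perms_with_cycle_length x l eq) (auto intro: finite_subset)
      moreover have "card {\<sigma> \<in> perms_with T A. card (orbit \<sigma> y) = l} = card (rooted_cycles T y l) * c"
        using less.prems by (intro card_perms_with_cycle_length y l eq) (auto intro: finite_subset)
      ultimately show ?thesis by simp
    qed
    then have "(\<Sum>l\<in>A \<inter> {1..card S}. card {\<sigma> \<in> perms_with S A. card (orbit \<sigma> x) = l})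
        = (\<Sum>l\<in>A \<inter> {1..card T}. card {\<sigma> \<in> perms_with T A. card (orbit \<sigma> y) = l})"
      using less.prems(3) by (intro sum.cong) auto
    then show ?thesis
      using card_perms_with_split[OF less.prems(1) x] card_perms_with_split[OF less.prems(2) y] by metis
  qed (use less.prems in simp)
qed

section \<open>The density of permutations with restricted cycle lengths\<close>

text \<open>The probability that a uniform permutation of n points has all cycle lengths in A. The argument
  is an integer and the value at negative arguments is 0, so that a(n - l) makes sense, and is right, when
  no l-cycle fits into n points.\<close>

definition perm_density :: "nat set \<Rightarrow> int \<Rightarrow> real" where
  "perm_density A m = (if m < 0 then 0 else real (card (restricted_perms (nat m) A)) / fact (nat m))"

lemma perm_density_nonneg: "0 \<le> perm_density A m"
  by (simp add: perm_density_def)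

lemma card_perms_with_eq_density:
  fixes S :: "nat set"
  shows "finite S \<Longrightarrow> real (card (perms_with S A)) = fact (card S) * perm_density A (int (card S))"
  using card_perms_with_cong[of S "{1..card S}" A] by (simp add: perm_density_def restricted_perms_eq)

lemma card_cycle_length_eq_density:
  fixes S :: "nat set"
  assumes fin: "finite S" and x: "x \<in> S" and l: "l \<in> A" "1 \<le> l"
  shows "real (card {\<sigma> \<in> perms_with S A. card (orbit \<sigma> x) = l})
    = fact (card S - 1) * perm_density A (int (card S) - int l)"
proof (cases "l \<le> card S")
  case True
  have "card (perms_with T A) = card (restricted_perms (card S - l) A)" 
    if "T \<subseteq> S" "card T = card S - l" for T
    unfolding restricted_perms_eq
    using that finite_subset[OF _ fin] by (intro card_perms_with_cong) auto
  from card_perms_with_cycle_length[OF fin x l(1) this]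
  have "real (card {\<sigma> \<in> perms_with S A. card (orbit \<sigma> x) = l}) 
      = real (card (rooted_cycles S x l)) * real (card (restricted_perms (card S - l) A))"
    by simp
  also have "real (card (restricted_perms (card S - l) A)) 
      = fact (card S - l) * perm_density A (int (card S) - int l)"
    using True by (simp add: perm_density_def nat_diff_distrib)
  also have "real (card (rooted_cycles S x l)) * (fact (card S - l) * perm_density A (int (card S) - int l))
      = real (card (rooted_cycles S x l) * fact (card S - l)) * perm_density A (int (card S) - int l)"
    by simp
  finally show ?thesis
    using card_rooted_cycles[OF fin x l(2) True] by simp
next
  case False
  have "{\<sigma> \<in> perms_with S A. card (orbit \<sigma> x) = l} = {}"
    using card_orbit_bounds(2)[OF _ fin x] False by (auto simp: perms_with_def)
  then have "card {\<sigma> \<in> perms_with S A. card (orbit \<sigma> x) = l} = 0"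
    by (simp only: card.empty)
  then show ?thesis
    using False by (simp add: perm_density_def)
qed


text \<open>Obtained by distinguishing the length l in A of the cycle of one point: that point lies in an l-cycle with
  probability a(n - l) / (n a(n)).\<close>

lemma perm_density_recurrence:
  assumes "0 < n"
  shows "real n * perm_density A (int n) = (\<Sum>l\<in>A \<inter> {1..n}. perm_density A (int n - int l))"
proof -
  have "fact n * perm_density A (int n) = real (card (perms_with {1..n} A))"
    using card_perms_with_eq_density[of "{1..n}" A] by simp
  also have "\<dots> = (\<Sum>l\<in>A \<inter> {1..n}. real (card {\<sigma> \<in> perms_with {1..n} A. card (orbit \<sigma> 1) = l}))"
    using card_perms_with_split[of "{1..n}" 1 A] assms by simp
  also have "\<dots> = (\<Sum>l\<in>A \<inter> {1..n}. fact (n - 1) * perm_density A (int n - int l))"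
    using card_cycle_length_eq_density[of "{1..n}" 1] assms by (intro sum.cong) auto
  also have "\<dots> = fact (n - 1) * (\<Sum>l\<in>A \<inter> {1..n}. perm_density A (int n - int l))"
    by (simp add: sum_distrib_left)
  also have "(fact n :: real) = fact (n - 1) * real n"
    using assms fact_reduce[of n] by (simp add: mult.commute)
  finally show ?thesis by simp
qed

definition points_in_cycles :: "'a set \<Rightarrow> nat \<Rightarrow> ('a \<Rightarrow> 'a) \<Rightarrow> nat" where
  "points_in_cycles S l \<sigma> = card {y \<in> S. card (orbit \<sigma> y) = l}"

lemma sum_points_in_cycles_mult:
  fixes g :: "('a \<Rightarrow> 'a) \<Rightarrow> real"
  assumes "finite S"
  shows "(\<Sum>\<sigma>\<in>perms_with S A. real (points_in_cycles S l \<sigma>) * g \<sigma>)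
    = (\<Sum>y\<in>S. \<Sum>\<sigma>\<in>{\<sigma> \<in> perms_with S A. card (orbit \<sigma> y) = l}. g \<sigma>)"
proof -
  have "(\<Sum>\<sigma>\<in>perms_with S A. real (points_in_cycles S l \<sigma>) * g \<sigma>)
      = (\<Sum>\<sigma>\<in>perms_with S A. \<Sum>y\<in>S. if card (orbit \<sigma> y) = l then g \<sigma> else 0)"
    using assms by (intro sum.cong) (simp_all add: points_in_cycles_def sum.If_cases Int_def)
  also have "\<dots> = (\<Sum>y\<in>S. \<Sum>\<sigma>\<in>perms_with S A. if card (orbit \<sigma> y) = l then g \<sigma> else 0)"
    by (rule sum.swap)
  also have "\<dots> = (\<Sum>y\<in>S. \<Sum>\<sigma>\<in>{\<sigma> \<in> perms_with S A. card (orbit \<sigma> y) = l}. g \<sigma>)"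
    using assms by (intro sum.cong refl sum.inter_filter[symmetric]) simp
  finally show ?thesis .
qed

lemma sum_points_in_cycles:
  fixes S :: "nat set"
  assumes "finite S" "l \<in> A" "1 \<le> l"
  shows "(\<Sum>\<sigma>\<in>perms_with S A. real (points_in_cycles S l \<sigma>))
    = fact (card S) * perm_density A (int (card S) - int l)"
proof (cases "S = {}")
  case False
  have "(\<Sum>\<sigma>\<in>perms_with S A. real (points_in_cycles S l \<sigma>))
      = (\<Sum>y\<in>S. real (card {\<sigma> \<in> perms_with S A. card (orbit \<sigma> y) = l}))"
    using sum_points_in_cycles_mult[OF assms(1), where g = "\<lambda>_. 1"] by simp
  also have "\<dots> = real (card S) * fact (card S - 1) * perm_density A (int (card S) - int l)"
    using card_cycle_length_eq_density[OF assms(1) _ assms(2,3)] by simp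
  also have "real (card S) * fact (card S - 1) = fact (card S)"
    using False assms fact_reduce[of "card S", where 'a = real] by (simp add: card_gt_0_iff)
  finally show ?thesis .
qed (use assms in \<open>simp add: points_in_cycles_def perm_density_def\<close>)

lemma points_in_cycles_glue:
  assumes fin: "finite S" and xs: "xs \<in> rooted_cycles S x l" and \<tau>: "\<tau> \<in> perms_with (S - set xs) A"
  shows "points_in_cycles S l (cycle_of_list xs \<circ> \<tau>) = l + points_in_cycles (S - set xs) l \<tau>"
proof -
  let ?\<sigma> = "cycle_of_list xs \<circ> \<tau>"
  have h: "distinct xs" "set xs \<subseteq> S" "length xs = l" "\<tau> permutes S - set xs"
    using xs \<tau> by (auto simp: rooted_cycles_def perms_with_def)
  note g = h(1,2,4)
  have on: "card (orbit ?\<sigma> y) = l" if "y \<in> set xs" for y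
    using orbit_glue_on_cycle[OF g that] distinct_card[OF h(1)] h(3) by simp
  have "{y \<in> S. card (orbit ?\<sigma> y) = l} = set xs \<union> {y \<in> S - set xs. card (orbit \<tau> y) = l}"
    using on orbit_glue_off_cycle[OF g] h(2) by (auto simp del: o_apply) 
  moreover have "card (set xs \<union> {y \<in> S - set xs. card (orbit \<tau> y) = l})
      = card (set xs) + card {y \<in> S - set xs. card (orbit \<tau> y) = l}"
    using fin by (intro card_Un_disjoint) auto
  ultimately show ?thesis
    using distinct_card[OF h(1)] h(3) by (simp add: points_in_cycles_def)
qed

text \<open>Given that y lies in an l-cycle, the other points carry a uniform permutation of the same kind. The number
  of points in l-cycles is therefore l plus an independent copy of that number for n - l points.\<close>

lemma sum_points_in_cycles_squared:
  fixes S :: "nat set"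
  assumes fin: "finite S" and l: "l \<in> A" "1 \<le> l" and lS: "l \<le> card S"
  shows "(\<Sum>\<sigma>\<in>perms_with S A. (real (points_in_cycles S l \<sigma>))\<^sup>2)
    = fact (card S) * (real l * perm_density A (int (card S) - int l)
        + perm_density A (int (card S) - 2 * int l))"
proof -
  let ?m = "card S - l"
  let ?c = "real l * (fact ?m * perm_density A (int ?m)) + fact ?m * perm_density A (int ?m - int l)"
  have "(\<Sum>\<sigma>\<in>{\<sigma> \<in> perms_with S A. card (orbit \<sigma> y) = l}. real (points_in_cycles S l \<sigma>))
      = fact (card S - 1) / fact ?m * ?c" if y: "y \<in> S" for y
  proof -
    have fin': "finite (rooted_cycles S y l)"
      by (rule finite_subset[OF _ finite_lists_length_eq[OF fin, of l]]) (auto simp: rooted_cycles_def)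
    have "(\<Sum>\<sigma>\<in>{\<sigma> \<in> perms_with S A. card (orbit \<sigma> y) = l}. real (points_in_cycles S l \<sigma>))
      = (\<Sum>(xs, \<tau>)\<in>(SIGMA xs:rooted_cycles S y l. perms_with (S - set xs) A).
          real (points_in_cycles S l (cycle_of_list xs \<circ> \<tau>)))"
      using sum.reindex_bij_betw[OF bij_betw_glue_cycle[OF fin y l(1)],
          of "\<lambda>\<sigma>. real (points_in_cycles S l \<sigma>)"]
      by (simp add: case_prod_unfold)
    also have "\<dots> = (\<Sum>xs\<in>rooted_cycles S y l. \<Sum>\<tau>\<in>perms_with (S - set xs) A.
        real (points_in_cycles S l (cycle_of_list xs \<circ> \<tau>)))"
      using fin fin' by (intro sum.Sigma[symmetric]) auto
    also have "\<dots> = (\<Sum>xs\<in>rooted_cycles S y l. ?c)"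
    proof (rule sum.cong[OF refl])
      fix xs assume xs: "xs \<in> rooted_cycles S y l"
      then have card: "card (S - set xs) = ?m"
        using fin by (auto simp: rooted_cycles_def card_Diff_subset distinct_card)
      have "(\<Sum>\<tau>\<in>perms_with (S - set xs) A. real (points_in_cycles S l (cycle_of_list xs \<circ> \<tau>)))
        = (\<Sum>\<tau>\<in>perms_with (S - set xs) A. real l + real (points_in_cycles (S - set xs) l \<tau>))"
        using points_in_cycles_glue[OF fin xs] by (intro sum.cong) auto
      also have "\<dots> = real l * real (card (perms_with (S - set xs) A))
          + (\<Sum>\<tau>\<in>perms_with (S - set xs) A. real (points_in_cycles (S - set xs) l \<tau>))"
        by (simp add: sum.distrib)
      also have "\<dots> = ?c"
        using card_perms_with_eq_density[of "S - set xs" A] sum_points_in_cycles[of "S - set xs" l A] fin l card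
        by simp
      finally show "(\<Sum>\<tau>\<in>perms_with (S - set xs) A. real (points_in_cycles S l (cycle_of_list xs \<circ> \<tau>))) = ?c" .
    qed
    also have "\<dots> = real (card (rooted_cycles S y l)) * ?c"
      by simp
    also have "real (card (rooted_cycles S y l)) = fact (card S - 1) / fact ?m"
      using arg_cong[OF card_rooted_cycles[OF fin y l(2) lS], of real] by (simp add: field_simps)
    finally show ?thesis .
  qed
  then have "(\<Sum>\<sigma>\<in>perms_with S A. (real (points_in_cycles S l \<sigma>))\<^sup>2)
      = real (card S) * (fact (card S - 1) / fact ?m * ?c)"
    using sum_points_in_cycles_mult[OF fin, where g = "\<lambda>\<sigma>. real (points_in_cycles S l \<sigma>)"]
    by (simp add: power2_eq_square)
  also have "\<dots> = (real (card S) * fact (card S - 1)) * (?c / fact ?m)"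
    by simp
  also have "real (card S) * fact (card S - 1) = fact (card S)"
    using l lS fact_reduce[of "card S", where 'a = real] by simp
  also have "?c / fact ?m = real l * perm_density A (int ?m) + perm_density A (int ?m - int l)"
    by (simp add: add_divide_distrib)
  finally show ?thesis using lS by (simp add: of_nat_diff algebra_simps)
qed

text \<open>Cauchy-Schwarz for the number of points in l-cycles. Divided by a(n) a(n - l), it says that the mean
  number for n points exceeds the mean number for n - l points by at most l.\<close>

lemma perm_density_second_moment:
  assumes l: "l \<in> A" "1 \<le> l" "l \<le> n"
  shows "(perm_density A (int n - int l))\<^sup>2
    \<le> perm_density A (int n) * (real l * perm_density A (int n - int l) + perm_density A (int n - 2 * int l))"
proof -
  let ?P = "perms_with {1..n} A" and ?X = "\<lambda>\<sigma>. real (points_in_cycles {1..n} l \<sigma>)"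
  have "(fact n * perm_density A (int n - int l))\<^sup>2 = (\<Sum>\<sigma>\<in>?P. ?X \<sigma>)\<^sup>2"
    using sum_points_in_cycles[of "{1..n}" l A] l by simp
  also have "\<dots> \<le> real (card ?P) * (\<Sum>\<sigma>\<in>?P. (?X \<sigma>)\<^sup>2)"
    using sum_squared_le_sum_of_squares[of ?X ?P] by (simp add: mult.commute)
  also have "\<dots> = (fact n)\<^sup>2 * (perm_density A (int n)
      * (real l * perm_density A (int n - int l) + perm_density A (int n - 2 * int l)))"
    using card_perms_with_eq_density[of "{1..n}" A] sum_points_in_cycles_squared[of "{1..n}" l A] l
    by (simp add: power2_eq_square)
  finally show ?thesis by (simp add: power_mult_distrib)
qed

section \<open>Cycles shorter than an allowed length are rare\<close>

lemma perm_density_step: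
  assumes "d \<in> A" "1 \<le> d" "m \<le> int n"
  shows "perm_density A (m - int d) \<le> real n * perm_density A m"
proof (cases "m - int d < 0")
  case True
  then show ?thesis by (simp add: perm_density_def)
next
  case False
  define m' where "m' = nat m"
  have m': "m = int m'" "0 < m'" "d \<le> m'" "m' \<le> n"
    using False assms by (auto simp: m'_def)
  have "perm_density A (int m' - int d) \<le> (\<Sum>l\<in>A \<inter> {1..m'}. perm_density A (int m' - int l))"
    using assms m' by (intro member_le_sum) (auto simp: perm_density_nonneg)
  also have "\<dots> = real m' * perm_density A (int m')"
    using perm_density_recurrence[OF m'(2)] by simp
  also have "\<dots> \<le> real n * perm_density A (int m')"
    using m' by (intro mult_right_mono perm_density_nonneg) auto
  finally show ?thesis by (simp add: m')
qed

lemma perm_density_steps: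
  assumes "d \<in> A" "1 \<le> d"
  shows "perm_density A (int n - int j * int d) \<le> real n ^ j * perm_density A (int n)"
proof (induction j)
  case (Suc j)
  have "perm_density A (int n - int (Suc j) * int d) = perm_density A ((int n - int j * int d) - int d)"
    by (simp add: algebra_simps)
  also have "\<dots> \<le> real n * perm_density A (int n - int j * int d)"
    using assms by (intro perm_density_step) auto
  also have "\<dots> \<le> real n * (real n ^ j * perm_density A (int n))"
    using Suc by (intro mult_left_mono) auto
  finally show ?case by simp
qed simp

lemma perm_density_second_moment_int:
  assumes "l \<in> A" "1 \<le> l"
  shows "(perm_density A (m - int l))\<^sup>2
    \<le> perm_density A m * (real l * perm_density A (m - int l) + perm_density A (m - 2 * int l))"
proof (cases "m < int l")
  case True
  then have "perm_density A (m - int l) = 0" by (simp add: perm_density_def)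
  then show ?thesis by (simp add: perm_density_nonneg)
next
  case False
  then show ?thesis
    using perm_density_second_moment[OF assms, of "nat m"] by simp
qed

text \<open>The ratio a(m - l) / a(m) loses at most l at each step of size l, by the second moment inequality. Starting
  above l d + T it stays above T for d steps.\<close>

lemma perm_density_ratio_decay:
  assumes l: "l \<in> A" "1 \<le> l"
    and pos: "0 < perm_density A m" and T: "0 < T"
    and b: "(real l * real d + T) * perm_density A m \<le> perm_density A (m - int l)"
    and j: "j < d"
  shows "0 < perm_density A (m - int j * int l) \<and>
    (real l * real (d - j) + T) * perm_density A (m - int j * int l) \<le> perm_density A (m - int (Suc j) * int l)"
  using j
proof (induction j)
  case 0
  then show ?case using pos b by simp
next
  case (Suc j)
  define p q r where "p = perm_density A (m - int j * int l)"
    and "q = perm_density A (m - int (Suc j) * int l)"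
    and "r = perm_density A (m - int (Suc (Suc j)) * int l)"
  have p: "0 < p" and pq: "(real l * real (d - j) + T) * p \<le> q"
    using Suc unfolding p_def q_def by auto
  have q: "0 < q"
    using pq p T by (smt (verit) mult_nonneg_nonneg mult_pos_pos of_nat_0_le_iff)
  have "q\<^sup>2 \<le> p * (real l * q + r)"
    using perm_density_second_moment_int[OF l, of "m - int j * int l"]
    unfolding p_def q_def r_def by (simp add: algebra_simps)
  moreover have "(real l * real (d - j) + T) * p * q \<le> q * q"
    using pq q by (intro mult_right_mono) auto
  ultimately have "p * ((real l * real (d - j) + T) * q) \<le> p * (real l * q + r)"
    by (simp add: power2_eq_square algebra_simps)
  then have "(real l * real (d - j) + T) * q \<le> real l * q + r"
    using p by simp
  moreover have "real (d - j) = real (d - Suc j) + 1"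
    using Suc.prems by (simp add: of_nat_diff)
  ultimately have "(real l * real (d - Suc j) + T) * q \<le> r"
    by (simp add: algebra_simps)
  then show ?case using q by (simp add: q_def r_def)
qed

text \<open>Two bounds for a(n - l d): d steps of size l, each with a ratio of at least T, and l steps of
  size d, each with a ratio of at most n.\<close>

lemma perm_density_ratio_bound:
  assumes l: "l \<in> A" "1 \<le> l" and d: "d \<in> A" "1 \<le> d"
    and pos: "0 < perm_density A (int n)" and T: "0 < T"
    and b: "(real l * real d + T) * perm_density A (int n) \<le> perm_density A (int n - int l)"
  shows "T ^ d \<le> real n ^ l"
proof -
  have "T ^ j * perm_density A (int n) \<le> perm_density A (int n - int j * int l)" if "j \<le> d" for j
    using that
  proof (induction j)
    case (Suc j)
    have step: "(real l * real (d - j) + T) * perm_density A (int n - int j * int l)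
        \<le> perm_density A (int n - int (Suc j) * int l)"
      using perm_density_ratio_decay[OF l pos T b, of j] Suc.prems by simp
    have "T ^ Suc j * perm_density A (int n) \<le> T * perm_density A (int n - int j * int l)"
      using Suc T by (simp add: mult.assoc)
    also have "\<dots> \<le> (real l * real (d - j) + T) * perm_density A (int n - int j * int l)"
      by (intro mult_right_mono perm_density_nonneg) auto
    finally show ?case using step by simp
  qed simp
  from this[of d] have "T ^ d * perm_density A (int n) \<le> perm_density A (int n - int l * int d)"
    by (simp add: mult.commute)
  also have "\<dots> \<le> real n ^ l * perm_density A (int n)"
    by (rule perm_density_steps[OF d])
  finally show ?thesis using pos by simp
qed

text \<open>As l < d, a ratio of order n is impossible in the preceding bound: n^d would be at most a constant times n^l.\<close>

lemma eventually_perm_density_small: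
  assumes l: "l \<in> A" "1 \<le> l" and d: "d \<in> A" "l < d" and \<epsilon>: "0 < \<epsilon>"
  shows "\<forall>\<^sub>F n in sequentially. perm_density A (int n - int l) \<le> \<epsilon> * real n * perm_density A (int n)"
proof -
  have 1: "\<forall>\<^sub>F n in sequentially. (\<epsilon> / 2) * real n \<ge> real l * real d" 
    using \<epsilon> by real_asymp
  have 2: "\<forall>\<^sub>F n in sequentially. (\<epsilon> / 2) ^ d * real n > 1"
    using \<epsilon> by (intro eventually_compose_filterlim[OF _ filterlim_real_sequentially])
       (simp add: eventually_at_top_dense, metis zero_less_power half_gt_zero pos_divide_less_eq mult.commute)
  show ?thesis
    using 1 2 eventually_gt_at_top[of 0]
  proof eventually_elim
    case (elim n)
    show ?case
    proof (cases "perm_density A (int n) = 0")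
      case True
      \<comment> \<open>no permutation of \<open>n\<close> points qualifies, so none of \<open>n - l\<close> points does\<close>
      then show ?thesis using perm_density_step[of l A "int n" n] l by simp
    next
      case False
      then have pos: "0 < perm_density A (int n)"
        using perm_density_nonneg[of A "int n"] by linarith
      show ?thesis
      proof (rule ccontr)
        assume "\<not> ?thesis"
        moreover have "(real l * real d + (\<epsilon> / 2) * real n) * perm_density A (int n)
            \<le> \<epsilon> * real n * perm_density A (int n)"
          using elim pos by (intro mult_right_mono) auto
        ultimately have "(real l * real d + (\<epsilon> / 2) * real n) * perm_density A (int n)
            \<le> perm_density A (int n - int l)"
          by linarith
        then have "((\<epsilon> / 2) * real n) ^ d \<le> real n ^ l"
          using l d elim \<epsilon> pos
          by (intro perm_density_ratio_bound[of l A d n "(\<epsilon> / 2) * real n"]) auto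
        also have "real n ^ l \<le> real n ^ (d - 1)"
          using elim d by (intro power_increasing) auto
        finally have "(\<epsilon> / 2) ^ d * real n * real n ^ (d - 1) \<le> 1 * real n ^ (d - 1)"
          unfolding power_mult_distrib[of "\<epsilon> / 2" "real n" d] using d
          by (cases d) (simp_all add: mult.assoc del: times_divide_eq_left)
        then have "(\<epsilon> / 2) ^ d * real n \<le> 1"
          by (rule mult_right_le_imp_le) (use elim in auto)
        with elim show False by simp
      qed
    qed
  qed
qed

lemma eventually_few_points_in_cycles:
  assumes "l \<in> A" "1 \<le> l" "d \<in> A" "l < d" "0 < \<epsilon>"
  shows "\<forall>\<^sub>F n in sequentially. (\<Sum>\<sigma>\<in>restricted_perms n A. real (points_in_cycles {1..n} l \<sigma>))
           \<le> \<epsilon> * real n * real (card (restricted_perms n A))"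
  using eventually_perm_density_small[OF assms]
proof eventually_elim
  case (elim n)
  have "(\<Sum>\<sigma>\<in>restricted_perms n A. real (points_in_cycles {1..n} l \<sigma>)) = fact n * perm_density A (int n - int l)"
    using sum_points_in_cycles[of "{1..n}" l A] assms by (simp add: restricted_perms_eq)
  also have "\<dots> \<le> fact n * (\<epsilon> * real n * perm_density A (int n))"
    using elim by (intro mult_left_mono) auto
  also have "fact n * perm_density A (int n) = real (card (restricted_perms n A))"
    using card_perms_with_eq_density[of "{1..n}" A] by (simp add: restricted_perms_eq)
  then have "fact n * (\<epsilon> * real n * perm_density A (int n)) = \<epsilon> * real n * real (card (restricted_perms n A))"
    by (metis mult.left_commute)
  finally show ?case .
qed

section \<open>Negligible properties of points\<close>

definition perm_tuples :: "nat \<Rightarrow> (nat \<Rightarrow> nat set) \<Rightarrow> nat \<Rightarrow> (nat \<Rightarrow> nat \<Rightarrow> nat) set" where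
  "perm_tuples k A n = (\<Pi>\<^sub>E i\<in>{1..k}. restricted_perms n (A i))"

lemma finite_restricted_perms [simp]: "finite (restricted_perms n A)"
  by (simp add: restricted_perms_eq)

lemma finite_perm_tuples [simp]: "finite (perm_tuples k A n)"
  unfolding perm_tuples_def by (rule finite_PiE) auto

lemma perm_tuples_permutes:
  "s \<in> perm_tuples k A n \<Longrightarrow> i \<in> {1..k} \<Longrightarrow> s i permutes {1..n}"
  by (auto simp: perm_tuples_def restricted_perms_def dest!: PiE_mem)

text \<open>The inequality is not divided by the number of tuples, so that it holds trivially for those n for which there is no
  tuple; limits along the admissible n thus become plain limits.\<close>

definition negligible :: "nat \<Rightarrow> (nat \<Rightarrow> nat set) \<Rightarrow> ((nat \<Rightarrow> nat \<Rightarrow> nat) \<Rightarrow> nat \<Rightarrow> bool) \<Rightarrow> bool" where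
  "negligible k A D \<longleftrightarrow> (\<forall>\<epsilon>>0. \<forall>\<^sub>F n in sequentially.
     (\<Sum>s\<in>perm_tuples k A n. real (card {x \<in> {1..n}. D s x})) \<le> \<epsilon> * real n * real (card (perm_tuples k A n)))"

lemma negligible_mono:
  assumes "negligible k A E"
    and "\<And>n s x. s \<in> perm_tuples k A n \<Longrightarrow> x \<in> {1..n} \<Longrightarrow> D s x \<Longrightarrow> E s x"
  shows "negligible k A D"
  unfolding negligible_def
proof (intro allI impI)
  fix \<epsilon> :: real assume "0 < \<epsilon>"
  with assms(1) have "\<forall>\<^sub>F n in sequentially. (\<Sum>s\<in>perm_tuples k A n. real (card {x \<in> {1..n}. E s x}))
      \<le> \<epsilon> * real n * real (card (perm_tuples k A n))"
    by (simp add: negligible_def)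
  then show "\<forall>\<^sub>F n in sequentially. (\<Sum>s\<in>perm_tuples k A n. real (card {x \<in> {1..n}. D s x}))
      \<le> \<epsilon> * real n * real (card (perm_tuples k A n))"
  proof eventually_elim
    case (elim n)
    have "(\<Sum>s\<in>perm_tuples k A n. real (card {x \<in> {1..n}. D s x}))
        \<le> (\<Sum>s\<in>perm_tuples k A n. real (card {x \<in> {1..n}. E s x}))"
      using assms(2) by (intro sum_mono of_nat_mono card_mono) auto
    with elim show ?case by linarith
  qed
qed

lemma negligible_False [simp]: "negligible k A (\<lambda>s x. False)"
  by (simp add: negligible_def)

lemma negligible_disj:
  assumes "negligible k A D" "negligible k A E"
  shows "negligible k A (\<lambda>s x. D s x \<or> E s x)"
  unfolding negligible_def
proof (intro allI impI)
  fix \<epsilon> :: real assume "0 < \<epsilon>"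
  then have "\<forall>\<^sub>F n in sequentially. (\<Sum>s\<in>perm_tuples k A n. real (card {x \<in> {1..n}. D s x}))
      \<le> (\<epsilon> / 2) * real n * real (card (perm_tuples k A n))"
    "\<forall>\<^sub>F n in sequentially. (\<Sum>s\<in>perm_tuples k A n. real (card {x \<in> {1..n}. E s x}))
      \<le> (\<epsilon> / 2) * real n * real (card (perm_tuples k A n))"
    using assms by (simp_all add: negligible_def del: times_divide_eq_left)
  then show "\<forall>\<^sub>F n in sequentially. (\<Sum>s\<in>perm_tuples k A n. real (card {x \<in> {1..n}. D s x \<or> E s x}))
      \<le> \<epsilon> * real n * real (card (perm_tuples k A n))"
  proof eventually_elim
    case (elim n)
    have "card {x \<in> {1..n}. D s x \<or> E s x} \<le> card {x \<in> {1..n}. D s x} + card {x \<in> {1..n}. E s x}" for s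
    proof -
      have "{x \<in> {1..n}. D s x \<or> E s x} = {x \<in> {1..n}. D s x} \<union> {x \<in> {1..n}. E s x}" by auto
      then show ?thesis by (simp add: card_Un_le)
    qed
    then have "(\<Sum>s\<in>perm_tuples k A n. real (card {x \<in> {1..n}. D s x \<or> E s x}))
        \<le> (\<Sum>s\<in>perm_tuples k A n. real (card {x \<in> {1..n}. D s x}) + real (card {x \<in> {1..n}. E s x}))"
      by (intro sum_mono) (simp flip: of_nat_add)
    with elim show ?case by (simp add: sum.distrib)
  qed
qed

lemma negligible_Bex:
  assumes "finite I" "\<And>i. i \<in> I \<Longrightarrow> negligible k A (D i)"
  shows "negligible k A (\<lambda>s x. \<exists>i\<in>I. D i s x)"
  using assms
proof (induction I rule: finite_induct)
  case (insert i I)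
  then show ?case using negligible_disj[of k A "D i" "\<lambda>s x. \<exists>i\<in>I. D i s x"] by simp
qed simp

lemma negligible_permuted:
  assumes "negligible k A D"
    and g: "\<And>n s. s \<in> perm_tuples k A n \<Longrightarrow> g s permutes {1..n}"
  shows "negligible k A (\<lambda>s x. D s (g s x))"
proof -
  have "card {x \<in> {1..n}. D s (g s x)} = card {x \<in> {1..n}. D s x}" if "s \<in> perm_tuples k A n" for s n
  proof -
    note p = g[OF that]
    have "bij_betw (g s) {x \<in> {1..n}. D s (g s x)} {x \<in> {1..n}. D s x}"
    proof (rule bij_betw_imageI)
      show "inj_on (g s) {x \<in> {1..n}. D s (g s x)}"
        using permutes_inj[OF p] by (auto intro: inj_on_subset)
      show "g s ` {x \<in> {1..n}. D s (g s x)} = {x \<in> {1..n}. D s x}"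
      proof (intro equalityI subsetI)
        fix y assume "y \<in> {x \<in> {1..n}. D s x}"
        moreover obtain x where "y = g s x" using permutes_surj[OF p] by blast
        ultimately show "y \<in> g s ` {x \<in> {1..n}. D s (g s x)}"
          using permutes_in_image[OF p, of x] by auto
      next
        fix y assume "y \<in> g s ` {x \<in> {1..n}. D s (g s x)}"
        then show "y \<in> {x \<in> {1..n}. D s x}" using permutes_in_image[OF p] by blast
      qed
    qed
    then show ?thesis by (rule bij_betw_same_card)
  qed
  then show ?thesis using assms(1) unfolding negligible_def by simp
qed

text \<open>Used to read off statements about one s_i from the count for a single permutation.\<close>

lemma sum_PiE_coordinate:
  fixes g :: "'b \<Rightarrow> real"
  assumes "finite I" "i \<in> I" "\<And>j. j \<in> I \<Longrightarrow> finite (B j)"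
  shows "(\<Sum>s\<in>PiE I B. g (s i)) = (\<Sum>\<sigma>\<in>B i. g \<sigma>) * (\<Prod>j\<in>I - {i}. real (card (B j)))"
proof -
  have "(\<Sum>s\<in>PiE I B. g (s i)) = (\<Sum>s\<in>PiE I B. \<Prod>j\<in>I. if j = i then g (s j) else 1)"
    using assms by (simp add: prod.delta)
  also have "\<dots> = (\<Prod>j\<in>I. \<Sum>\<sigma>\<in>B j. if j = i then g \<sigma> else 1)"
    using assms by (intro prod_sum_PiE[symmetric]) auto
  also have "\<dots> = (\<Sum>\<sigma>\<in>B i. g \<sigma>) * (\<Prod>j\<in>I - {i}. \<Sum>\<sigma>\<in>B j. if j = i then g \<sigma> else 1)"
    using assms by (subst prod.remove[of I i]) auto
  also have "(\<Prod>j\<in>I - {i}. \<Sum>\<sigma>\<in>B j. if j = i then g \<sigma> else 1) = (\<Prod>j\<in>I - {i}. real (card (B j)))"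
    by (intro prod.cong) auto
  finally show ?thesis .
qed

lemma negligible_cycle_length:
  assumes i: "i \<in> {1..k}" and l: "l \<in> A i" "1 \<le> l" and d: "d \<in> A i" "l < d"
  shows "negligible k A (\<lambda>s x. card (orbit (s i) x) = l)"
  unfolding negligible_def
proof (intro allI impI)
  fix \<epsilon> :: real assume "0 < \<epsilon>"
  from eventually_few_points_in_cycles[OF l d this]
  show "\<forall>\<^sub>F n in sequentially. (\<Sum>s\<in>perm_tuples k A n. real (card {x \<in> {1..n}. card (orbit (s i) x) = l}))
      \<le> \<epsilon> * real n * real (card (perm_tuples k A n))"
  proof eventually_elim
    case (elim n)
    let ?c = "\<Prod>j\<in>{1..k} - {i}. real (card (restricted_perms n (A j)))"
    have "real (card (perm_tuples k A n)) = real (card (restricted_perms n (A i))) * ?c"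
      using sum_PiE_coordinate[of "{1..k}" i "\<lambda>j. restricted_perms n (A j)" "\<lambda>_. 1"] i
      by (simp add: perm_tuples_def)
    moreover have "(\<Sum>s\<in>perm_tuples k A n. real (card {x \<in> {1..n}. card (orbit (s i) x) = l}))
        = (\<Sum>\<sigma>\<in>restricted_perms n (A i). real (points_in_cycles {1..n} l \<sigma>)) * ?c"
      using sum_PiE_coordinate[of "{1..k}" i "\<lambda>j. restricted_perms n (A j)"
          "\<lambda>\<sigma>. real (points_in_cycles {1..n} l \<sigma>)"] i
      by (simp add: perm_tuples_def points_in_cycles_def)
    moreover have "0 \<le> ?c" by (simp add: prod_nonneg)
    ultimately show ?case
      using mult_right_mono[OF elim, of ?c] by (simp add: mult.assoc)
  qed
qed

section \<open>Loops of words in independent permutations\<close>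

type_synonym syllable = "letter \<times> nat"

abbreviation generator :: "syllable \<Rightarrow> nat" where
  "generator t \<equiv> fst (fst t)"

definition eval_syllable :: "(nat \<Rightarrow> nat \<Rightarrow> nat) \<Rightarrow> syllable \<Rightarrow> nat \<Rightarrow> nat" where
  "eval_syllable s t = eval_letter s (fst t) ^^ snd t"

text \<open>The first syllable of the list acts first, so that prefixes of the list describe the path of a point.\<close>

definition run :: "(nat \<Rightarrow> nat \<Rightarrow> nat) \<Rightarrow> syllable list \<Rightarrow> nat \<Rightarrow> nat" where
  "run s ts = fold (eval_syllable s) ts"

text \<open>A loop based at y that does not pass through y in between.\<close>

definition first_return :: "(nat \<Rightarrow> nat \<Rightarrow> nat) \<Rightarrow> syllable list \<Rightarrow> nat \<Rightarrow> bool" where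
  "first_return s ts y \<longleftrightarrow> run s ts y = y \<and> (\<forall>j. 0 < j \<and> j < length ts \<longrightarrow> run s (take j ts) y \<noteq> y)"

lemma run_append: "run s (us @ ts) x = run s ts (run s us x)"
  by (simp add: run_def)

lemma run_Nil [simp]: "run s [] x = x" and run_Cons [simp]: "run s (t # ts) x = run s ts (eval_syllable s t x)"
  by (simp_all add: run_def)

lemma eval_letter_permutes:
  assumes "s \<in> perm_tuples k A n" "fst a \<in> {1..k}"
  shows "eval_letter s a permutes {1..n}"
  using perm_tuples_permutes[OF assms] by (simp add: eval_letter_def permutes_inv)

lemma eval_syllable_permutes:
  assumes "s \<in> perm_tuples k A n" "generator t \<in> {1..k}"
  shows "eval_syllable s t permutes {1..n}"
  unfolding eval_syllable_def by (intro permutes_funpow eval_letter_permutes[OF assms])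

lemma run_permutes:
  assumes "s \<in> perm_tuples k A n" "\<forall>t\<in>set ts. generator t \<in> {1..k}"
  shows "run s ts permutes {1..n}"
  using assms(2)
proof (induction ts)
  case Nil
  then show ?case using permutes_id[of "{1..n}"] by (simp add: run_def id_def)
next
  case (Cons t ts)
  have eq: "run s (t # ts) = run s ts \<circ> eval_syllable s t" by (simp add: fun_eq_iff)
  have "eval_syllable s t permutes {1..n}"
    using Cons.prems by (intro eval_syllable_permutes[OF assms(1)]) simp
  then show ?case
    unfolding eq by (rule permutes_compose) (use Cons in simp)
qed

abbreviation swap :: "'a \<Rightarrow> 'a \<Rightarrow> 'a \<Rightarrow> 'a" where
  "swap \<equiv> Transposition.transpose"

definition conjugate_by_swap :: "nat \<Rightarrow> nat \<Rightarrow> nat \<Rightarrow> (nat \<Rightarrow> nat \<Rightarrow> nat) \<Rightarrow> nat \<Rightarrow> nat \<Rightarrow> nat" where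
  "conjugate_by_swap i y z s = s(i := swap y z \<circ> s i \<circ> swap y z)"

lemma conjugate_by_swap_involutory: "conjugate_by_swap i y z (conjugate_by_swap i y z s) = s"
  by (auto simp: conjugate_by_swap_def fun_eq_iff)

lemma restricted_perms_conjugate:
  assumes \<sigma>: "\<sigma> \<in> restricted_perms n B" and yz: "y \<in> {1..n}" "z \<in> {1..n}"
  shows "swap y z \<circ> \<sigma> \<circ> swap y z \<in> restricted_perms n B"
proof -
  let ?\<tau> = "swap y z" and ?\<sigma>' = "swap y z \<circ> \<sigma> \<circ> swap y z"
  have perm: "\<sigma> permutes {1..n}" and B: "\<And>x. x \<in> {1..n} \<Longrightarrow> card (orbit \<sigma> x) \<in> B"
    using \<sigma> by (auto simp: restricted_perms_eq perms_with_def)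
  have \<tau>: "?\<tau> permutes {1..n}" by (rule permutes_swap_id[OF yz])
  have "card (orbit ?\<sigma>' x) \<in> B" if x: "x \<in> {1..n}" for x
  proof -
    have "permutation \<sigma>" using perm by (auto simp: permutation_permutes)
    then have "?\<tau> ` orbit \<sigma> (?\<tau> x) = orbit ?\<sigma>' (?\<tau> (?\<tau> x))"
      by (intro orbit_inverse permutation_self_in_orbit) auto
    then have "orbit ?\<sigma>' x = ?\<tau> ` orbit \<sigma> (?\<tau> x)" by simp
    then have "card (orbit ?\<sigma>' x) = card (orbit \<sigma> (?\<tau> x))"
      by (simp only: card_image[OF permutes_inj_on[OF \<tau>]])
    then show ?thesis using B permutes_in_image[OF \<tau>] x by simp
  qed
  then show ?thesis
    using permutes_compose[OF \<tau> permutes_compose[OF perm \<tau>]]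
    by (auto simp: restricted_perms_eq perms_with_def o_assoc permutes_compose[OF \<tau>] perm \<tau>)
qed

lemma conjugate_by_swap_in_perm_tuples:
  assumes "s \<in> perm_tuples k A n" "i \<in> {1..k}" "y \<in> {1..n}" "z \<in> {1..n}"
  shows "conjugate_by_swap i y z s \<in> perm_tuples k A n"
  using assms restricted_perms_conjugate[of "s i" n "A i" y z]
  by (auto simp: perm_tuples_def conjugate_by_swap_def PiE_iff extensional_def)

lemma eval_syllable_conjugate:
  assumes "s \<in> perm_tuples k A n" "generator t \<in> {1..k}"
  shows "eval_syllable (conjugate_by_swap i y z s) t =
    (if generator t = i then swap y z \<circ> eval_syllable s t \<circ> swap y z else eval_syllable s t)"
proof -
  let ?\<tau> = "swap y z"
  have bij: "bij (s (generator t))"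
    using perm_tuples_permutes[OF assms] by (rule permutes_bij)
  have "inv_into UNIV (?\<tau> \<circ> s (generator t) \<circ> ?\<tau>) = ?\<tau> \<circ> inv_into UNIV (s (generator t)) \<circ> ?\<tau>"
    using bij by (simp add: o_inv_distrib bij_comp o_assoc)
  then have letter: "eval_letter (conjugate_by_swap i y z s) (fst t) =
      (if generator t = i then ?\<tau> \<circ> eval_letter s (fst t) \<circ> ?\<tau> else eval_letter s (fst t))"
    by (auto simp: eval_letter_def conjugate_by_swap_def)
  have "(?\<tau> \<circ> f \<circ> ?\<tau>) ^^ e = ?\<tau> \<circ> f ^^ e \<circ> ?\<tau>" for f e
    by (induction e) (auto simp: fun_eq_iff)
  then show ?thesis by (simp add: eval_syllable_def letter)
qed

text \<open>The loop enters its base point y only by its last edge, with label i, and leaves it by an edge with another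
  label. Conjugating s_i by the transposition of y and z, where z is off the loop, therefore
  affects the last edge only, which now ends at z.\<close>

lemma run_conjugate_first_return:
  assumes s: "s \<in> perm_tuples k A n" and ts: "\<forall>t\<in>set ts. generator t \<in> {1..k}" "2 \<le> length ts"
    and hd_last: "generator (hd ts) \<noteq> generator (last ts)"
    and ret: "first_return s ts y"
    and z: "\<And>j. j < length ts \<Longrightarrow> run s (take j ts) y \<noteq> z"
  shows "run (conjugate_by_swap (generator (last ts)) y z s) ts y = z"
proof -
  define i q where "i = generator (last ts)" and "q = length ts"
  let ?s = "conjugate_by_swap i y z s"
  have pos: "run s (take j ts) y \<noteq> y" "run s (take j ts) y \<noteq> z" if "0 < j" "j < q" for j
    using ret z that by (auto simp: first_return_def q_def)
  have step: "run s' (take (Suc j) ts) y = eval_syllable s' (ts ! j) (run s' (take j ts) y)" if "j < q" for s' j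
    using that by (simp add: take_Suc_conv_app_nth run_append q_def)
  have gen: "generator (ts ! j) \<in> {1..k}" if "j < q" for j
    using ts that by (simp add: q_def)
  have "run ?s (take j ts) y = run s (take j ts) y" if "j < q" for j
    using that
  proof (induction j)
    case (Suc j)
    show ?case
    proof (cases "generator (ts ! j) = i")
      case True
      \<comment> \<open>the first syllable uses another generator, so this edge starts away from \<open>y\<close>\<close>
      then have "0 < j"
        using hd_last ts(2) by (cases ts; cases j) (auto simp: i_def)
      then show ?thesis
        using Suc True pos[of j] pos[of "Suc j"] step[of j]
        by (simp add: eval_syllable_conjugate[OF s gen])
    qed (use Suc step[of j] in \<open>simp add: eval_syllable_conjugate[OF s gen]\<close>)
  qed simp
  from this[of "q - 1"] have before: "run ?s (take (q - 1) ts) y = run s (take (q - 1) ts) y"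
    using ts(2) by (simp add: q_def)
  have "ts \<noteq> []" using ts(2) by auto
  then have last: "ts ! (q - 1) = last ts" and full: "take (Suc (q - 1)) ts = ts" and q: "q - 1 < q" "0 < q - 1"
    using ts(2) by (auto simp: q_def last_conv_nth)
  have "eval_syllable s (last ts) (run s (take (q - 1) ts) y) = y"
    using step[of "q - 1" s] ret q unfolding last full by (simp add: first_return_def)
  then show ?thesis
    using step[of "q - 1" ?s] q pos[of "q - 1"] gen[of "q - 1"] before unfolding last full
    by (simp add: eval_syllable_conjugate[OF s] flip: i_def)
qed

text \<open>The new tuple and y determine z as the end of the path, and then the old tuple. So the triples consisting of a tuple, a
  base point y of a loop and a point z off the loop inject into the pairs of a tuple and a point.\<close>

lemma sum_first_returns_le:
  assumes ts: "\<forall>t\<in>set ts. generator t \<in> {1..k}" "2 \<le> length ts"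
    and hd_last: "generator (hd ts) \<noteq> generator (last ts)"
  shows "(\<Sum>s\<in>perm_tuples k A n. card {y \<in> {1..n}. first_return s ts y}) * (n - length ts)
    \<le> n * card (perm_tuples k A n)"
proof -
  define i q where "i = generator (last ts)" and "q = length ts"
  let ?Y = "\<lambda>s. {y \<in> {1..n}. first_return s ts y}"
  let ?Z = "\<lambda>s y. {1..n} - (\<lambda>j. run s (take j ts) y) ` {..<q}"
  let ?T = "SIGMA s:perm_tuples k A n. SIGMA y:?Y s. ?Z s y"
  let ?\<Phi> = "\<lambda>(s, y, z). (conjugate_by_swap i y z s, y)"
  have i: "i \<in> {1..k}"
    using ts by (cases ts) (auto simp: i_def)
  have Z: "n - q \<le> card (?Z s y)" for s y
  proof -
    have "card ((\<lambda>j. run s (take j ts) y) ` {..<q}) \<le> q"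
      by (metis card_image_le card_lessThan finite_lessThan)
    then show ?thesis
      using diff_card_le_card_Diff[of "(\<lambda>j. run s (take j ts) y) ` {..<q}" "{1..n}"] by simp
  qed
  have "(\<Sum>s\<in>perm_tuples k A n. card (?Y s)) * (n - q) = (\<Sum>s\<in>perm_tuples k A n. \<Sum>y\<in>?Y s. n - q)"
    by (simp add: sum_distrib_right)
  also have "\<dots> \<le> (\<Sum>s\<in>perm_tuples k A n. \<Sum>y\<in>?Y s. card (?Z s y))"
    by (intro sum_mono Z)
  also have "\<dots> = card ?T"
    by (subst card_SigmaI) (auto simp: card_SigmaI)
  also have "\<dots> = card (?\<Phi> ` ?T)"
  proof (rule card_image[symmetric], rule inj_onI)
    fix p p' assume p: "p \<in> ?T" "p' \<in> ?T" "?\<Phi> p = ?\<Phi> p'"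
    obtain s y z s' z' where eq: "p = (s, y, z)" "p' = (s', y, z')"
        "conjugate_by_swap i y z s = conjugate_by_swap i y z' s'"
      using p(3) by (cases p; cases p') auto
    have "run (conjugate_by_swap i y z s) ts y = z"
      unfolding i_def using p eq by (intro run_conjugate_first_return[OF _ ts hd_last]) (auto simp: q_def)
    moreover have "run (conjugate_by_swap i y z' s') ts y = z'"
      unfolding i_def using p eq by (intro run_conjugate_first_return[OF _ ts hd_last]) (auto simp: q_def)
    ultimately have "z = z'" using eq by simp
    then show "p = p'"
      using eq conjugate_by_swap_involutory by metis
  qed
  also have "\<dots> \<le> card (perm_tuples k A n \<times> {1..n})"
    using i by (intro card_mono) (auto intro!: conjugate_by_swap_in_perm_tuples)
  finally show ?thesis by (simp add: q_def card_cartesian_product mult.commute)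
qed

lemma negligible_first_return:
  assumes ts: "\<forall>t\<in>set ts. generator t \<in> {1..k}" "2 \<le> length ts"
    and hd_last: "generator (hd ts) \<noteq> generator (last ts)"
  shows "negligible k A (\<lambda>s. first_return s ts)"
  unfolding negligible_def
proof (intro allI impI)
  fix \<epsilon> :: real assume \<epsilon>: "0 < \<epsilon>"
  define q where "q = length ts"
  have "\<forall>\<^sub>F n in sequentially. 1 \<le> \<epsilon> * (real n - real q)"
    using \<epsilon> by real_asymp
  then show "\<forall>\<^sub>F n in sequentially. (\<Sum>s\<in>perm_tuples k A n. real (card {y \<in> {1..n}. first_return s ts y}))
      \<le> \<epsilon> * real n * real (card (perm_tuples k A n))"
    using eventually_ge_at_top[of q]
  proof eventually_elim
    case (elim n)
    let ?S = "\<Sum>s\<in>perm_tuples k A n. real (card {y \<in> {1..n}. first_return s ts y})"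
    have "?S * (real n - real q) \<le> real n * real (card (perm_tuples k A n))"
      using of_nat_mono[OF sum_first_returns_le[OF ts hd_last, where A = A and n = n], where 'a = real] elim
      by (simp add: q_def of_nat_diff)
    then have "\<epsilon> * (?S * (real n - real q)) \<le> \<epsilon> * (real n * real (card (perm_tuples k A n)))"
      using \<epsilon> by (intro mult_left_mono) auto
    moreover have "?S * 1 \<le> ?S * (\<epsilon> * (real n - real q))"
      using elim by (intro mult_left_mono sum_nonneg) auto
    ultimately show ?case by (simp add: algebra_simps)
  qed
qed

text \<open>Take positions a < b at minimal distance at which the path of x is at the same point. If
  b = a + 1, one syllable fixes that point. Otherwise no point repeats in between, so the loop can be
  based at the point in position a + 1, where the edges entering and leaving it carry different generators
  when consecutive syllables do. The loop read from there starts with syllable a + 1 and ends with syllable a.\<close>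

lemma closed_run_cases:
  assumes closed: "run s ts x = x" and ne: "ts \<noteq> []"
  shows "(\<exists>a<length ts. eval_syllable s (ts ! a) (run s (take a ts) x) = run s (take a ts) x) \<or>
    (\<exists>(a, b)\<in>{(a, b). a + 2 \<le> b \<and> b \<le> length ts}.
      first_return s (drop (Suc a) (take b ts) @ [ts ! a]) (run s (take (Suc a) ts) x))"
proof -
  define pos where "pos j = run s (take j ts) x" for j
  define loop where "loop = (\<lambda>g. \<exists>a. 0 < g \<and> a + g \<le> length ts \<and> pos a = pos (a + g))"
  have step: "pos (Suc j) = eval_syllable s (ts ! j) (pos j)" if "j < length ts" for j
    using that by (simp add: pos_def take_Suc_conv_app_nth run_append)
  have "loop (length ts)"
    using closed ne by (auto simp: loop_def pos_def)
  then have g: "loop (LEAST g. loop g)"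
    by (rule LeastI)
  define g where "g = (LEAST g. loop g)"
  obtain a where a: "0 < g" "a + g \<le> length ts" "pos a = pos (a + g)"
    using g by (auto simp: loop_def g_def)
  show ?thesis
  proof (cases "g = 1")
    case True
    then have "eval_syllable s (ts ! a) (pos a) = pos a"
      using a step[of a] by simp
    moreover have "a < length ts" using a by simp
    ultimately show ?thesis unfolding pos_def by blast
  next
    case False
    define us where "us = drop (Suc a) (take (a + g) ts)"
    have len: "length us = g - 1" using a by (simp add: us_def)
    have run_us: "run s (take j us) (pos (Suc a)) = pos (Suc a + j)" if "j \<le> g - 1" for j
    proof -
      have "take (Suc a + j) ts = take (Suc a) ts @ take j us"
        using that by (simp only: us_def drop_take take_take take_add[of "Suc a" j ts]) (simp add: min_absorb1)
      then show ?thesis by (simp add: pos_def run_append)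
    qed
    have "run s (us @ [ts ! a]) (pos (Suc a)) = pos (Suc a)"
      using run_us[of "g - 1"] len a step[of a] by (simp add: run_append)
    moreover have "run s (take j (us @ [ts ! a])) (pos (Suc a)) \<noteq> pos (Suc a)"
      if "0 < j" "j < length (us @ [ts ! a])" for j
    proof
      assume "run s (take j (us @ [ts ! a])) (pos (Suc a)) = pos (Suc a)"
      then have "pos (Suc a) = pos (Suc a + j)"
        using run_us[of j] that len by simp
      then have "loop j"
        unfolding loop_def using that len a by (intro exI[of _ "Suc a"]) auto
      then show False using not_less_Least[of j loop] that len a by (simp add: g_def)
    qed
    ultimately have "first_return s (us @ [ts ! a]) (pos (Suc a))"
      by (simp add: first_return_def)
    moreover have "a + 2 \<le> a + g" using False a by simp
    ultimately show ?thesis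
      using a unfolding us_def pos_def by (intro disjI2 bexI[of _ "(a, a + g)"]) auto
  qed
qed

lemma negligible_fixed_run:
  assumes gen: "\<forall>t\<in>set ts. generator t \<in> {1..k}" and ne: "ts \<noteq> []"
    and adj: "distinct_adj (map generator ts)"
    and syl: "\<And>t. t \<in> set ts \<Longrightarrow> negligible k A (\<lambda>s x. eval_syllable s t x = x)"
  shows "negligible k A (\<lambda>s x. run s ts x = x)"
proof -
  let ?P = "{(a, b). a + 2 \<le> b \<and> b \<le> length ts}"
  have gen': "\<forall>t\<in>set (take j ts). generator t \<in> {1..k}" for j
    using gen by (auto dest: in_set_takeD)
  have 1: "negligible k A (\<lambda>s x. \<exists>a\<in>{..<length ts}. eval_syllable s (ts ! a) (run s (take a ts) x) = run s (take a ts) x)"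
  proof (rule negligible_Bex)
    fix a assume "a \<in> {..<length ts}"
    then have "negligible k A (\<lambda>s x. eval_syllable s (ts ! a) x = x)"
      by (intro syl) simp
    from negligible_permuted[OF this run_permutes[OF _ gen', of _ A _ a]]
    show "negligible k A (\<lambda>s x. eval_syllable s (ts ! a) (run s (take a ts) x) = run s (take a ts) x)"
      by simp
  qed simp
  have "finite ?P"
    by (rule finite_subset[of _ "{..length ts} \<times> {..length ts}"]) auto
  moreover have "negligible k A (\<lambda>s x. first_return s (drop (Suc a) (take b ts) @ [ts ! a]) (run s (take (Suc a) ts) x))"
    if ab: "a + 2 \<le> b" "b \<le> length ts" for a b
  proof (rule negligible_permuted[where D = "\<lambda>s. first_return s (drop (Suc a) (take b ts) @ [ts ! a])"])
    show "negligible k A (\<lambda>s. first_return s (drop (Suc a) (take b ts) @ [ts ! a]))"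
    proof (rule negligible_first_return)
      show "\<forall>t\<in>set (drop (Suc a) (take b ts) @ [ts ! a]). generator t \<in> {1..k}"
        using gen ab by (auto dest!: in_set_dropD in_set_takeD)
      have "hd (drop (Suc a) (take b ts) @ [ts ! a]) = ts ! Suc a"
        using ab by (simp add: hd_append hd_drop_conv_nth)
      moreover have "generator (ts ! a) \<noteq> generator (ts ! Suc a)"
        using adj ab by (simp add: distinct_adj_conv_nth)
      ultimately show "generator (hd (drop (Suc a) (take b ts) @ [ts ! a]))
          \<noteq> generator (last (drop (Suc a) (take b ts) @ [ts ! a]))"
        by simp
    qed (use ab in simp)
  qed (rule run_permutes[OF _ gen'])
  ultimately have 2: "negligible k A (\<lambda>s x. \<exists>p\<in>?P. case p of (a, b) \<Rightarrow>
      first_return s (drop (Suc a) (take b ts) @ [ts ! a]) (run s (take (Suc a) ts) x))"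
    by (intro negligible_Bex) auto
  show ?thesis
  proof (rule negligible_mono[OF negligible_disj[OF 1 2]])
    fix s x assume "run s ts x = x"
    from closed_run_cases[OF this ne]
    show "(\<exists>a\<in>{..<length ts}. eval_syllable s (ts ! a) (run s (take a ts) x) = run s (take a ts) x) \<or>
      (\<exists>p\<in>?P. case p of (a, b) \<Rightarrow>
        first_return s (drop (Suc a) (take b ts) @ [ts ! a]) (run s (take (Suc a) ts) x))"
      by (simp only: Bex_def lessThan_iff)
  qed
qed

section \<open>Words, the free group and the relator subgroup\<close>

lemma inv_letter_inv_letter [simp]: "inv_letter (inv_letter a) = a"
  and fst_inv_letter [simp]: "fst (inv_letter a) = fst a"
  by (simp_all add: inv_letter_def)

lemma reduced_word_Nil [simp]: "reduced_word []"
  by (simp add: reduced_word_def)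

lemma reduced_word_Cons:
  "reduced_word (a # w) \<longleftrightarrow> reduced_word w \<and> (w \<noteq> [] \<longrightarrow> hd w \<noteq> inv_letter a)"
  by (cases w) (auto simp: reduced_word_def nth_Cons split: nat.splits)

lemma words_over_simps [simp]: "[] \<in> words_over k" 
  "a # w \<in> words_over k \<longleftrightarrow> fst a \<in> {1..k} \<and> w \<in> words_over k"
  "u @ w \<in> words_over k \<longleftrightarrow> u \<in> words_over k \<and> w \<in> words_over k"
  by (auto simp: words_over_def)

lemma push_letter_in_words_over: "fst a \<in> {1..k} \<Longrightarrow> w \<in> words_over k \<Longrightarrow> push_letter a w \<in> words_over k"
  by (cases w) auto

lemma reduced_push_letter: "reduced_word w \<Longrightarrow> reduced_word (push_letter a w)"
  by (cases w) (auto simp: reduced_word_Cons)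

lemma push_letter_cancel: "reduced_word w \<Longrightarrow> push_letter (inv_letter a) (push_letter a w) = w"
proof (cases w)
  case (Cons b v)
  then show "reduced_word w \<Longrightarrow> ?thesis" by (cases v) (auto simp: reduced_word_Cons)
qed simp

lemma reduced_reduce_word: "reduced_word (reduce_word w)"
  unfolding reduce_word_def by (induction w) (auto simp: reduced_push_letter)

lemma reduce_word_in_words_over: "w \<in> words_over k \<Longrightarrow> reduce_word w \<in> words_over k"
  unfolding reduce_word_def by (induction w) (simp_all add: push_letter_in_words_over)

lemma reduce_word_in_carrier: "w \<in> words_over k \<Longrightarrow> reduce_word w \<in> carrier (free_group k)"
  by (simp add: free_group_def reduced_reduce_word reduce_word_in_words_over)

lemma reduce_word_reduced: "reduced_word w \<Longrightarrow> reduce_word w = w"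
proof (induction w)
  case (Cons a w)
  then show ?case by (cases w) (auto simp: reduced_word_Cons reduce_word_def)
qed (simp add: reduce_word_def)

lemma reduce_word_Cons: "reduce_word (a # w) = push_letter a (reduce_word w)"
  by (simp add: reduce_word_def)

text \<open>Reduction is an action of words on reduced words: a letter that cancels on pushing acts as the
  inverse of the one that it cancels.\<close>

lemma foldr_push_letter_push:
  assumes "reduced_word w"
  shows "foldr push_letter (push_letter a u) w = push_letter a (foldr push_letter u w)"
proof (cases u)
  case (Cons b v)
  have "reduced_word (foldr push_letter v w)" for v
    using assms by (induction v) (auto simp: reduced_push_letter)
  then show ?thesis
    using Cons push_letter_cancel[of "foldr push_letter v w" "inv_letter a"] by auto
qed simp

lemma reduce_word_append_reduce: "reduce_word (reduce_word u @ v) = reduce_word (u @ v)"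
proof (induction u)
  case (Cons a u)
  have "reduce_word (reduce_word (a # u) @ v) = foldr push_letter (push_letter a (reduce_word u)) (reduce_word v)"
    by (simp add: reduce_word_def)
  also have "\<dots> = push_letter a (foldr push_letter (reduce_word u) (reduce_word v))"
    by (rule foldr_push_letter_push[OF reduced_reduce_word])
  also have "\<dots> = push_letter a (reduce_word (reduce_word u @ v))"
    by (simp add: reduce_word_def)
  finally show ?case using Cons by (simp add: reduce_word_def)
qed (simp add: reduce_word_def)

lemma reduce_word_append_reduce': "reduce_word (u @ reduce_word v) = reduce_word (u @ v)"
  using reduce_word_reduced[OF reduced_reduce_word, of v] by (simp add: reduce_word_def)

lemma mult_reduce_word:
  "reduce_word u \<otimes>\<^bsub>free_group k\<^esub> reduce_word v = reduce_word (u @ v)"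
  by (simp add: free_group_def reduce_word_append_reduce reduce_word_append_reduce')

lemma one_free_group: "\<one>\<^bsub>free_group k\<^esub> = []"
  by (simp add: free_group_def)

lemma pow_reduce_word:
  "reduce_word w [^]\<^bsub>free_group k\<^esub> m = reduce_word (concat (replicate m w))"
proof (induction m)
  case 0
  then show ?case by (simp add: one_free_group reduce_word_def nat_pow_def)
next
  case (Suc m)
  have "reduce_word w [^]\<^bsub>free_group k\<^esub> Suc m = reduce_word (concat (replicate m w)) \<otimes>\<^bsub>free_group k\<^esub> reduce_word w"
    using Suc by (simp add: nat_pow_def)
  also have "\<dots> = reduce_word (concat (replicate m w) @ w)"
    by (rule mult_reduce_word)
  also have "concat (replicate m w) @ w = concat (replicate (Suc m) w)"
    by (induction m) auto
  finally show ?case .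
qed

lemma reduce_word_cancel: "reduce_word (a # inv_letter a # w) = reduce_word w"
  using push_letter_cancel[OF reduced_reduce_word, of "inv_letter a" w] by (simp add: reduce_word_Cons)

lemma reduce_word_inv_cancel: "reduce_word (u @ rev (map inv_letter u)) = []"
proof (induction u rule: rev_induct)
  case (snoc a u)
  have "reduce_word ((u @ [a]) @ rev (map inv_letter (u @ [a])))
      = reduce_word (u @ reduce_word (a # inv_letter a # rev (map inv_letter u)))"
    by (simp add: reduce_word_append_reduce')
  also have "\<dots> = reduce_word (u @ rev (map inv_letter u))"
    by (simp add: reduce_word_cancel reduce_word_append_reduce')
  finally show ?case using snoc by simp
qed (simp add: reduce_word_def)

lemma inv_in_words_over: "u \<in> words_over k \<Longrightarrow> rev (map inv_letter u) \<in> words_over k"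
  by (auto simp: words_over_def)

lemma inv_reduce_word:
  assumes "u \<in> words_over k"
  shows "inv\<^bsub>free_group k\<^esub> (reduce_word u) = reduce_word (rev (map inv_letter u))"
proof -
  interpret F: group "free_group k" by (rule free_group_is_group)
  have "rev (map inv_letter (rev (map inv_letter u))) = u"
    by (simp add: rev_map o_def)
  then have "reduce_word (rev (map inv_letter u) @ u) = []"
    using reduce_word_inv_cancel[of "rev (map inv_letter u)"] by simp
  then show ?thesis
    using F.inv_equality[OF _ reduce_word_in_carrier[OF assms] reduce_word_in_carrier[OF inv_in_words_over[OF assms]]]
    by (simp add: mult_reduce_word one_free_group)
qed

lemma carrier_free_groupE:
  assumes "u \<in> carrier (free_group k)"
  shows "u \<in> words_over k" "reduce_word u = u"
  using assms by (simp_all add: free_group_def reduce_word_reduced)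

lemma eval_word_simps [simp]: "eval_word s [] = id" "eval_word s (a # w) = eval_letter s a \<circ> eval_word s w"
  by (simp_all add: eval_word_def)

lemma eval_word_append: "eval_word s (u @ w) = eval_word s u \<circ> eval_word s w"
  by (induction u) (auto simp: o_assoc)

lemma eval_word_permutes:
  assumes "s \<in> perm_tuples k A n" "w \<in> words_over k"
  shows "eval_word s w permutes {1..n}"
  using assms(2)
proof (induction w)
  case Nil
  then show ?case using permutes_id[of "{1..n}"] by (simp add: id_def)
next
  case (Cons a w)
  then show ?case
    unfolding eval_word_simps by (intro permutes_compose eval_letter_permutes[OF assms(1)]) auto
qed

lemma eval_letter_inv:
  assumes "s \<in> perm_tuples k A n" "fst a \<in> {1..k}"
  shows "eval_letter s a \<circ> eval_letter s (inv_letter a) = id" 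
  using permutes_inv_o[OF perm_tuples_permutes[OF assms]]
  by (cases a) (auto simp: eval_letter_def inv_letter_def)

lemma eval_push_letter:
  assumes "s \<in> perm_tuples k A n" "fst a \<in> {1..k}"
  shows "eval_word s (push_letter a w) = eval_letter s a \<circ> eval_word s w"
  using eval_letter_inv[OF assms] by (cases w) (auto simp: o_assoc)

lemma eval_reduce_word:
  assumes "s \<in> perm_tuples k A n" "w \<in> words_over k"
  shows "eval_word s (reduce_word w) = eval_word s w"
  using assms(2) by (induction w) (auto simp: reduce_word_Cons eval_push_letter[OF assms(1)] reduce_word_def)

lemma eval_word_concat_replicate: "eval_word s (concat (replicate m w)) = eval_word s w ^^ m"
  by (induction m) (auto simp: eval_word_append)

lemma eval_word_replicate: "eval_word s (replicate m a) = eval_letter s a ^^ m"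
  by (induction m) auto

lemma normal_normal_closure:
  assumes "group G" "R \<subseteq> carrier G"
  shows "normal_closure G R \<lhd> G"
proof -
  interpret group G by fact
  have "carrier G \<lhd> G"
    by (simp add: normal_inv_iff subgroup_self)
  then have ne: "{N. N \<lhd> G \<and> R \<subseteq> N} \<noteq> {}" using assms by blast
  then have "subgroup (\<Inter>{N. N \<lhd> G \<and> R \<subseteq> N}) G"
    by (intro subgroups_Inter) (auto simp: normal_inv_iff)
  then show ?thesis
    by (auto simp: normal_closure_def normal_inv_iff)
qed

lemma normal_closure_least: "N \<lhd> G \<Longrightarrow> R \<subseteq> N \<Longrightarrow> normal_closure G R \<subseteq> N"
  by (auto simp: normal_closure_def)

lemma subset_normal_closure: "R \<subseteq> normal_closure G R"
  by (auto simp: normal_closure_def)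

abbreviation generator_order :: "nat set \<Rightarrow> enat" where
  "generator_order B \<equiv> (SUP a\<in>B. enat a)"

lemma power_relators_eq:
  "power_relators k A = {reduce_word (replicate m (i, True)) | i m. i \<in> {1..k} \<and> generator_order (A i) = enat m}"
proof -
  have "concat (replicate m [a]) = replicate m a" for m and a :: letter
    by (induction m) auto
  then have "[a] [^]\<^bsub>free_group k\<^esub> m = reduce_word (replicate m a)" for a and m :: nat
    using pow_reduce_word[of k "[a]" m] by (simp add: reduce_word_def)
  then show ?thesis by (simp add: power_relators_def)
qed

lemma power_relators_in_carrier: "power_relators k A \<subseteq> carrier (free_group k)"
  unfolding power_relators_eq by (auto intro!: reduce_word_in_carrier simp: words_over_def)

lemma normal_relator_subgroup: "relator_subgroup k A \<lhd> free_group k"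
  unfolding relator_subgroup_def
  by (rule normal_normal_closure[OF free_group_is_group power_relators_in_carrier])

lemma power_in_relator_subgroup:
  assumes "fst a \<in> {1..k}" "generator_order (A (fst a)) = enat m"
  shows "reduce_word (replicate m a) \<in> relator_subgroup k A"
proof -
  interpret N: normal "relator_subgroup k A" "free_group k" by (rule normal_relator_subgroup)
  let ?b = "(fst a, True)"
  have b: "reduce_word (replicate m ?b) \<in> relator_subgroup k A"
    using subset_normal_closure assms unfolding relator_subgroup_def power_relators_eq by fast
  show ?thesis
  proof (cases "snd a")
    case True
    then have "a = ?b" by (simp add: prod_eq_iff)
    then show ?thesis using b by simp
  next
    case False
    then have "a = inv_letter ?b" by (simp add: prod_eq_iff inv_letter_def)
    moreover have "replicate m ?b \<in> words_over k" using assms by (auto simp: words_over_def)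
    ultimately show ?thesis
      using N.m_inv_closed[OF b] by (simp add: inv_reduce_word)
  qed
qed

text \<open>u r v is the product of the conjugate u r u^{-1} of a relator with u v.\<close>

lemma relator_subgroup_delete_power:
  assumes a: "fst a \<in> {1..k}" "generator_order (A (fst a)) = enat m"
    and uv: "u \<in> words_over k" "v \<in> words_over k"
    and N: "reduce_word (u @ v) \<in> relator_subgroup k A"
  shows "reduce_word (u @ replicate m a @ v) \<in> relator_subgroup k A"
proof -
  interpret N: normal "relator_subgroup k A" "free_group k" by (rule normal_relator_subgroup)
  define p q r where "p = reduce_word u" and "q = reduce_word v" and "r = reduce_word (replicate m a)"
  have r: "r \<in> relator_subgroup k A"
    unfolding r_def by (rule power_in_relator_subgroup[of a k A m]) fact+
  have c: "p \<in> carrier (free_group k)" "q \<in> carrier (free_group k)" "r \<in> carrier (free_group k)"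
    using uv N.mem_carrier[OF r] by (auto simp: p_def q_def intro: reduce_word_in_carrier)
  have "p \<otimes>\<^bsub>free_group k\<^esub> r \<otimes>\<^bsub>free_group k\<^esub> inv\<^bsub>free_group k\<^esub> p \<otimes>\<^bsub>free_group k\<^esub> (p \<otimes>\<^bsub>free_group k\<^esub> q)
      \<in> relator_subgroup k A"
    using N subgroup.m_closed[OF N.subgroup_axioms N.inv_op_closed2[OF c(1) r]]
    by (simp add: p_def q_def mult_reduce_word)
  also have "p \<otimes>\<^bsub>free_group k\<^esub> r \<otimes>\<^bsub>free_group k\<^esub> inv\<^bsub>free_group k\<^esub> p \<otimes>\<^bsub>free_group k\<^esub> (p \<otimes>\<^bsub>free_group k\<^esub> q)
      = p \<otimes>\<^bsub>free_group k\<^esub> (r \<otimes>\<^bsub>free_group k\<^esub> q)"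
    using c by (simp add: N.m_assoc N.inv_solve_left flip: N.m_assoc[of "inv\<^bsub>free_group k\<^esub> p"])
  also have "\<dots> = reduce_word (u @ replicate m a @ v)"
    by (simp add: p_def q_def r_def mult_reduce_word)
  finally show ?thesis .
qed

lemma reduce_word_delete_cancel:
  "reduce_word (u @ [a, inv_letter a] @ v) = reduce_word (u @ v)"
  using reduce_word_append_reduce'[of u "a # inv_letter a # v"]
  by (simp add: reduce_word_cancel reduce_word_append_reduce')

section \<open>Which words fix most points\<close>

locale nonempty_cycle_lengths =
  fixes k :: nat and A :: "nat \<Rightarrow> nat set"
  assumes lengths: "\<And>i. i \<in> {1..k} \<Longrightarrow> A i \<noteq> {} \<and> 0 \<notin> A i"
begin

lemma generator_order_finite:
  assumes "i \<in> {1..k}" "generator_order (A i) = enat m"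
  shows "m \<in> A i" "finite (A i)" "\<And>l. l \<in> A i \<Longrightarrow> l \<le> m"
proof -
  show le: "l \<le> m" if "l \<in> A i" for l
    using SUP_upper[OF that, of enat] assms(2) by simp
  then show fin: "finite (A i)"
    by (intro finite_subset[of "A i" "{..m}"]) auto
  have "enat (Max (A i)) = enat m"
    unfolding assms(2)[symmetric] using fin lengths[OF assms(1)]
    by (intro antisym SUP_upper SUP_least) auto
  then show "m \<in> A i" using Max_in[OF fin] lengths[OF assms(1)] by auto
qed

lemma exists_longer_cycle_length:
  assumes i: "i \<in> {1..k}" and e: "\<And>m. generator_order (A i) = enat m \<Longrightarrow> e < m"
  shows "\<exists>d\<in>A i. e < d"
proof (rule ccontr)
  assume "\<not> ?thesis"
  then have "\<forall>l\<in>A i. l \<le> e" by auto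
  then have "generator_order (A i) \<le> enat e" by (intro SUP_least) auto
  then obtain m where "generator_order (A i) = enat m" "m \<le> e" by (metis enat_ile enat_ord_simps(1))
  with e show False by fastforce
qed

lemma eval_syllable_fixes_iff:
  assumes "s \<in> perm_tuples k A n" "generator t \<in> {1..k}"
  shows "eval_syllable s t x = x \<longleftrightarrow> card (orbit (s (generator t)) x) dvd snd t"
proof -
  have "permutation (s (generator t))"
    using perm_tuples_permutes[OF assms] by (auto simp: permutation_permutes)
  then show ?thesis
    by (auto simp: eval_syllable_def eval_letter_def funpow_fixes_iff_card_orbit_dvd permutation_inverse orbit_inv_eq)
qed

lemma card_orbit_in:
  assumes "s \<in> perm_tuples k A n" "i \<in> {1..k}" "x \<in> {1..n}"
  shows "card (orbit (s i) x) \<in> A i"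
  using PiE_mem[OF assms(1)[unfolded perm_tuples_def] assms(2)] assms(3)
  by (simp add: restricted_perms_eq perms_with_def)

text \<open>For finite d_i, all allowed lengths other than d_i are shorter and hence rare, so a typical
  point lies in a cycle of length d_i.\<close>

lemma negligible_full_power_moves:
  assumes t: "generator t \<in> {1..k}" "generator_order (A (generator t)) = enat (snd t)"
  shows "negligible k A (\<lambda>s x. eval_syllable s t x \<noteq> x)"
proof -
  note fin = generator_order_finite[OF t]
  have "negligible k A (\<lambda>s x. \<exists>l\<in>A (generator t) - {snd t}. card (orbit (s (generator t)) x) = l)"
  proof (rule negligible_Bex)
    fix l assume l: "l \<in> A (generator t) - {snd t}"
    then have "l \<noteq> 0" "l < snd t" using lengths[OF t(1)] fin(3)[of l] by (auto intro: le_neq_implies_less)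
    then show "negligible k A (\<lambda>s x. card (orbit (s (generator t)) x) = l)"
      using l fin(1) by (intro negligible_cycle_length[OF t(1), where d = "snd t"]) auto
  qed (use fin in simp)
  then show ?thesis
    by (rule negligible_mono) (use card_orbit_in t in \<open>auto simp: eval_syllable_fixes_iff\<close>)
qed

text \<open>A point fixed by the e-th power lies in a cycle of length at most e, and some allowed length exceeds e.\<close>

lemma negligible_partial_power_fixes:
  assumes t: "generator t \<in> {1..k}" "0 < snd t"
    and less: "\<And>m. generator_order (A (generator t)) = enat m \<Longrightarrow> snd t < m"
  shows "negligible k A (\<lambda>s x. eval_syllable s t x = x)"
proof -
  obtain d where d: "d \<in> A (generator t)" "snd t < d"
    using exists_longer_cycle_length[OF t(1) less] by blast
  have "negligible k A (\<lambda>s x. \<exists>l\<in>A (generator t) \<inter> {1..snd t}. card (orbit (s (generator t)) x) = l)"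
    using d by (intro negligible_Bex negligible_cycle_length[OF t(1), where d = d]) auto
  then show ?thesis
  proof (rule negligible_mono)
    fix n s x assume s: "s \<in> perm_tuples k A n" and x: "x \<in> {1..n}" and fixed: "eval_syllable s t x = x"
    have "card (orbit (s (generator t)) x) \<in> A (generator t)"
      by (rule card_orbit_in[OF s t(1) x])
    moreover have "card (orbit (s (generator t)) x) dvd snd t"
      using fixed eval_syllable_fixes_iff[OF s t(1)] by simp
    ultimately show "\<exists>l\<in>A (generator t) \<inter> {1..snd t}. card (orbit (s (generator t)) x) = l"
      using t(2) lengths[OF t(1)] by (auto dest: dvd_imp_le simp: Suc_le_eq intro: Nat.gr0I)
  qed
qed

text \<open>Neither a cancelling pair nor a full power g_i^{d_i} or g_i^{-d_i} can be deleted. Such words play the part of the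
  normal forms of the free product, up to the choice of exponents modulo d_i.\<close>

definition irreducible_word :: "gen_word \<Rightarrow> bool" where
  "irreducible_word v \<longleftrightarrow> reduced_word v \<and>
     (\<forall>u a m v'. fst a \<in> {1..k} \<longrightarrow> generator_order (A (fst a)) = enat m \<longrightarrow> v \<noteq> u @ replicate m a @ v')"

lemma not_reduced_wordE:
  assumes "\<not> reduced_word v"
  obtains u a v' where "v = u @ [a, inv_letter a] @ v'"
proof -
  obtain j where j: "Suc j < length v" "v ! Suc j = inv_letter (v ! j)"
    using assms by (auto simp: reduced_word_def)
  have "drop j v = v ! j # v ! Suc j # drop (Suc (Suc j)) v"
    using j Cons_nth_drop_Suc[of j v] Cons_nth_drop_Suc[of "Suc j" v] by simp
  then have "v = take j v @ [v ! j, inv_letter (v ! j)] @ drop (Suc (Suc j)) v"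
    using append_take_drop_id[of j v] j by simp
  then show ?thesis by (rule that)
qed

text \<open>Delete cancelling pairs and full powers as long as possible. A deletion changes neither
  membership in the relator subgroup nor, up to a negligible set, the action on points.\<close>

lemma exists_irreducible_word:
  assumes "v \<in> words_over k"
  shows "\<exists>v'\<in>words_over k. irreducible_word v' \<and>
    (reduce_word v' \<in> relator_subgroup k A \<longrightarrow> reduce_word v \<in> relator_subgroup k A) \<and>
    negligible k A (\<lambda>s x. eval_word s v x \<noteq> eval_word s v' x)"
  using assms
proof (induction "length v" arbitrary: v rule: less_induct)
  case less
  show ?case
  proof (cases "irreducible_word v")
    case True
    then show ?thesis using less.prems by (intro bexI[of _ v]) auto
  next
    case False
    have "\<exists>w\<in>words_over k. length w < length v \<and>
      (reduce_word w \<in> relator_subgroup k A \<longrightarrow> reduce_word v \<in> relator_subgroup k A) \<and>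
      negligible k A (\<lambda>s x. eval_word s v x \<noteq> eval_word s w x)"
    proof (cases "reduced_word v")
      case False
      then obtain u a v' where v: "v = u @ [a, inv_letter a] @ v'" by (rule not_reduced_wordE)
      have "negligible k A (\<lambda>s x. eval_word s v x \<noteq> eval_word s (u @ v') x)"
      proof (rule negligible_mono[OF negligible_False])
        fix n s x assume s: "s \<in> perm_tuples k A n" and ne: "eval_word s v x \<noteq> eval_word s (u @ v') x"
        have "u @ v' \<in> words_over k" using less.prems v by simp
        then have "eval_word s v = eval_word s (u @ v')"
          using eval_reduce_word[OF s less.prems] eval_reduce_word[OF s, of "u @ v'"]
            reduce_word_delete_cancel[of u a v'] v by simp
        with ne show False by simp
      qed
      then show ?thesis
        using less.prems reduce_word_delete_cancel[of u a v'] v by (intro bexI[of _ "u @ v'"]) auto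
    next
      case True
      with False obtain u a m v' where a: "fst a \<in> {1..k}" "generator_order (A (fst a)) = enat m"
          and v: "v = u @ replicate m a @ v'"
        by (auto simp: irreducible_word_def)
      have uv: "u \<in> words_over k" "v' \<in> words_over k" using less.prems v by simp_all
      have "negligible k A (\<lambda>s x. eval_syllable s (a, m) (eval_word s v' x) \<noteq> eval_word s v' x)"
      proof (rule negligible_permuted[where D = "\<lambda>s x. eval_syllable s (a, m) x \<noteq> x"])
        show "negligible k A (\<lambda>s x. eval_syllable s (a, m) x \<noteq> x)"
          using a by (intro negligible_full_power_moves) simp_all
      qed (rule eval_word_permutes[OF _ uv(2)])
      then have "negligible k A (\<lambda>s x. eval_word s v x \<noteq> eval_word s (u @ v') x)"
        by (rule negligible_mono) (auto simp: v eval_word_append eval_word_replicate eval_syllable_def)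
      moreover have "length (u @ v') < length v"
        using generator_order_finite(1)[OF a] lengths[OF a(1)] v by (auto intro: Nat.gr0I)
      moreover have "reduce_word (u @ v') \<in> relator_subgroup k A \<longrightarrow> reduce_word v \<in> relator_subgroup k A"
        using relator_subgroup_delete_power[of a k A m, OF a uv] v by simp
      ultimately show ?thesis using uv by (intro bexI[of _ "u @ v'"]) auto
    qed
    then obtain w where w: "w \<in> words_over k" "length w < length v"
        "reduce_word w \<in> relator_subgroup k A \<longrightarrow> reduce_word v \<in> relator_subgroup k A"
        "negligible k A (\<lambda>s x. eval_word s v x \<noteq> eval_word s w x)" by blast
    from less.hyps[OF w(2,1)] obtain v' where v': "v' \<in> words_over k" "irreducible_word v'"
        "reduce_word v' \<in> relator_subgroup k A \<longrightarrow> reduce_word w \<in> relator_subgroup k A"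
        "negligible k A (\<lambda>s x. eval_word s w x \<noteq> eval_word s v' x)" by blast
    have "negligible k A (\<lambda>s x. eval_word s v x \<noteq> eval_word s v' x)"
      by (rule negligible_mono[OF negligible_disj[OF w(4) v'(4)]]) auto
    with v' w(3) show ?thesis by blast
  qed
qed

abbreviation expand :: "syllable list \<Rightarrow> gen_word" where
  "expand ts \<equiv> concat (map (\<lambda>t. replicate (snd t) (fst t)) ts)"

text \<open>In a reduced word, adjacent letters of the same generator are equal, so maximal blocks of one generator are powers
  of one letter.\<close>

lemma exists_syllables:
  assumes "reduced_word v"
  shows "\<exists>ts. v = expand ts \<and> (\<forall>t\<in>set ts. 0 < snd t) \<and> distinct_adj (map generator ts)"
  using assms
proof (induction v)
  case Nil
  then show ?case by (intro exI[of _ "[]"]) simp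
next
  case (Cons a v)
  then obtain ts where ts: "v = expand ts" "\<forall>t\<in>set ts. 0 < snd t" "distinct_adj (map generator ts)"
    by (auto simp: reduced_word_Cons)
  show ?case
  proof (cases ts)
    case Nil
    then show ?thesis using ts by (intro exI[of _ "[(a, 1)]"]) simp
  next
    case (Cons t ts')
    obtain b e where t: "t = (b, Suc e)"
      using ts(2) Cons by (cases t) (auto simp: gr0_conv_Suc)
    have v: "v = b # replicate e b @ expand ts'" using ts(1) Cons t by simp
    show ?thesis
    proof (cases "b = a")
      case True
      then show ?thesis
        using ts Cons t v by (intro exI[of _ "(a, Suc (Suc e)) # ts'"]) (simp add: distinct_adj_Cons)
    next
      case False
      moreover have "b \<noteq> inv_letter a" using Cons.prems v by (simp add: reduced_word_Cons)
      ultimately have "fst a \<noteq> fst b" by (cases a; cases b) (auto simp: inv_letter_def)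
      then show ?thesis
        using ts Cons t v by (intro exI[of _ "(a, 1) # ts"]) simp
    qed
  qed
qed

lemma eval_word_expand: "eval_word s (expand ts) x = run s (rev ts) x"
  by (induction ts) (simp_all add: eval_word_append eval_word_replicate run_append eval_syllable_def)

lemma negligible_fixed_irreducible:
  assumes v: "v \<in> words_over k" "irreducible_word v" "v \<noteq> []"
  shows "negligible k A (\<lambda>s x. eval_word s v x = x)"
proof -
  obtain ts where ts: "v = expand ts" "\<forall>t\<in>set ts. 0 < snd t" "distinct_adj (map generator ts)"
    using exists_syllables[of v] v(2) unfolding irreducible_word_def by blast
  have gen: "generator t \<in> {1..k}" if "t \<in> set ts" for t
  proof -
    have "fst t \<in> set v" using ts that by force
    then show ?thesis using v(1) by (auto simp: words_over_def)
  qed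
  have less: "snd t < m" if t: "t \<in> set ts" and m: "generator_order (A (generator t)) = enat m" for t m
  proof (rule ccontr)
    assume "\<not> snd t < m"
    then have "replicate (snd t) (fst t) = replicate m (fst t) @ replicate (snd t - m) (fst t)"
      by (simp flip: replicate_add)
    moreover obtain us us' where "ts = us @ t # us'" using t by (meson split_list)
    ultimately have "v = expand us @ replicate m (fst t) @ (replicate (snd t - m) (fst t) @ expand us')"
      using ts(1) by simp
    then show False using v(2) gen[OF t] m unfolding irreducible_word_def by blast
  qed
  have "negligible k A (\<lambda>s x. run s (rev ts) x = x)"
    using gen ts v(3) less
    by (intro negligible_fixed_run negligible_partial_power_fixes) (auto simp: rev_map[symmetric])
  then show ?thesis by (simp add: ts(1) eval_word_expand)
qed

lemma negligible_fixed_points: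
  assumes v: "v \<in> words_over k" "reduce_word v \<notin> relator_subgroup k A"
  shows "negligible k A (\<lambda>s x. eval_word s v x = x)"
proof -
  obtain v' where v': "v' \<in> words_over k" "irreducible_word v'" "reduce_word v' \<notin> relator_subgroup k A"
      "negligible k A (\<lambda>s x. eval_word s v x \<noteq> eval_word s v' x)"
    using exists_irreducible_word[OF v(1)] v(2) by blast
  interpret N: normal "relator_subgroup k A" "free_group k" by (rule normal_relator_subgroup)
  have "v' \<noteq> []" using v'(3) subgroup.one_closed[OF N.subgroup_axioms] by (auto simp: one_free_group reduce_word_def)
  from negligible_disj[OF negligible_fixed_irreducible[OF v'(1,2) this] v'(4)] show ?thesis
    by (rule negligible_mono) metis
qed

text \<open>The elements that move a negligible set of points form a normal subgroup that contains the relators: a product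
  moves only points that one of its factors moves, and u h u^{-1} moves the image under u of the points that h moves.\<close>

lemma negligible_moved_points:
  assumes "v \<in> relator_subgroup k A"
  shows "negligible k A (\<lambda>s x. eval_word s v x \<noteq> x)"
proof -
  interpret F: group "free_group k" by (rule free_group_is_group)
  define H where "H = {v \<in> carrier (free_group k). negligible k A (\<lambda>s x. eval_word s v x \<noteq> x)}"
  have over: "u \<in> words_over k" if "u \<in> carrier (free_group k)" for u
    using carrier_free_groupE[OF that] by simp
  have mult: "eval_word s (u \<otimes>\<^bsub>free_group k\<^esub> v) = eval_word s u \<circ> eval_word s v"
    if "s \<in> perm_tuples k A n" "u \<in> carrier (free_group k)" "v \<in> carrier (free_group k)" for s n u v
    using that mult_reduce_word[of k u v] carrier_free_groupE[of u k] carrier_free_groupE[of v k]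
    by (simp add: eval_reduce_word eval_word_append)
  have inv: "eval_word s (inv\<^bsub>free_group k\<^esub> u) (eval_word s u x) = x"
      "eval_word s u (eval_word s (inv\<^bsub>free_group k\<^esub> u) x) = x"
    if "s \<in> perm_tuples k A n" "u \<in> carrier (free_group k)" for s n u x
    using mult[OF that(1) F.inv_closed[OF that(2)] that(2)] mult[OF that F.inv_closed[OF that(2)]] that(2)
    by (simp_all add: one_free_group fun_eq_iff)
  have "subgroup H (free_group k)"
  proof (rule F.subgroupI)
    show "H \<noteq> {}" using F.one_closed by (auto simp: H_def one_free_group)
    fix u assume u: "u \<in> H"
    have "negligible k A (\<lambda>s x. eval_word s (inv\<^bsub>free_group k\<^esub> u) x \<noteq> x)"
    proof (rule negligible_mono)
      show "negligible k A (\<lambda>s x. eval_word s u x \<noteq> x)" using u by (simp add: H_def)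
      show "eval_word s u x \<noteq> x"
        if "s \<in> perm_tuples k A n" "eval_word s (inv\<^bsub>free_group k\<^esub> u) x \<noteq> x" for s n x
        using that inv(1)[of s n u x] u by (auto simp: H_def)
    qed
    then show "inv\<^bsub>free_group k\<^esub> u \<in> H" using u by (simp add: H_def)
    fix v assume v: "v \<in> H"
    have "negligible k A (\<lambda>s x. eval_word s (u \<otimes>\<^bsub>free_group k\<^esub> v) x \<noteq> x)"
      by (rule negligible_mono[OF negligible_disj[of k A "\<lambda>s x. eval_word s u x \<noteq> x" "\<lambda>s x. eval_word s v x \<noteq> x"]])
         (use u v mult in \<open>auto simp: H_def\<close>)
    then show "u \<otimes>\<^bsub>free_group k\<^esub> v \<in> H" using u v by (simp add: H_def)
  qed (auto simp: H_def)
  moreover have "u \<otimes>\<^bsub>free_group k\<^esub> h \<otimes>\<^bsub>free_group k\<^esub> inv\<^bsub>free_group k\<^esub> u \<in> H"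
    if u: "u \<in> carrier (free_group k)" and h: "h \<in> H" for u h
  proof -
    have hc: "h \<in> carrier (free_group k)" and hn: "negligible k A (\<lambda>s x. eval_word s h x \<noteq> x)"
      using h by (auto simp: H_def)
    have "negligible k A (\<lambda>s x. eval_word s h (eval_word s (inv\<^bsub>free_group k\<^esub> u) x) \<noteq> eval_word s (inv\<^bsub>free_group k\<^esub> u) x)"
      by (rule negligible_permuted[OF hn eval_word_permutes[OF _ over[OF F.inv_closed[OF u]]]])
    then have "negligible k A (\<lambda>s x. eval_word s (u \<otimes>\<^bsub>free_group k\<^esub> h \<otimes>\<^bsub>free_group k\<^esub> inv\<^bsub>free_group k\<^esub> u) x \<noteq> x)"
      by (rule negligible_mono) (use u hc inv in \<open>auto simp: mult\<close>)
    then show ?thesis using u hc by (simp add: H_def)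
  qed
  ultimately have "H \<lhd> free_group k" by (simp add: F.normal_inv_iff)
  moreover have "power_relators k A \<subseteq> H"
  proof
    fix r assume "r \<in> power_relators k A"
    then obtain i m where i: "i \<in> {1..k}" "generator_order (A i) = enat m" and r: "r = reduce_word (replicate m (i, True))"
      by (auto simp: power_relators_eq)
    have "replicate m (i, True) \<in> words_over k" using i by (auto simp: words_over_def)
    then have "eval_word s r = eval_syllable s ((i, True), m)" if "s \<in> perm_tuples k A n" for s n
      using eval_reduce_word[OF that] by (simp add: r eval_word_replicate eval_syllable_def)
    then have "negligible k A (\<lambda>s x. eval_word s r x \<noteq> x)"
      using negligible_full_power_moves[of "((i, True), m)"] i by (auto elim: negligible_mono)
    then show "r \<in> H"
      using power_relators_in_carrier \<open>r \<in> power_relators k A\<close> by (auto simp: H_def)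
  qed
  ultimately have "relator_subgroup k A \<subseteq> H"
    unfolding relator_subgroup_def by (rule normal_closure_least)
  then show ?thesis using assms by (auto simp: H_def)
qed

end

lemma word_power_in_relator_subgroup_iff:
  assumes w: "w \<in> words_over k" "reduced_word w"
  shows "reduce_word (concat (replicate m w)) \<in> relator_subgroup k A
    \<longleftrightarrow> group.ord (quotient_group k A) (word_class k A w) dvd m"
proof -
  interpret N: normal "relator_subgroup k A" "free_group k" by (rule normal_relator_subgroup)
  interpret Q: group "quotient_group k A"
    unfolding quotient_group_def by (rule N.factorgroup_is_group)
  interpret proj: group_hom "free_group k" "quotient_group k A" "word_class k A"
  proof (intro group_hom.intro group_hom_axioms.intro free_group_is_group Q.group_axioms)
    show "word_class k A \<in> hom (free_group k) (quotient_group k A)"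
      using N.r_coset_hom_Mod by (simp add: quotient_group_def word_class_def[abs_def])
  qed
  have w': "w \<in> carrier (free_group k)"
    using w by (simp add: free_group_def)
  define v where "v = w [^]\<^bsub>free_group k\<^esub> m"
  have v: "v \<in> carrier (free_group k)" using w' by (simp add: v_def)
  have "v = reduce_word (concat (replicate m w))"
    using pow_reduce_word[of k w m] w by (simp add: v_def reduce_word_reduced)
  moreover have "v \<in> relator_subgroup k A \<longleftrightarrow> word_class k A v = \<one>\<^bsub>quotient_group k A\<^esub>"
    using N.coset_join1[OF _ v N.subgroup_axioms] N.coset_join2[OF v N.subgroup_axioms] N.subset
    by (auto simp: quotient_group_def word_class_def)
  moreover have "word_class k A v = word_class k A w [^]\<^bsub>quotient_group k A\<^esub> m"
    unfolding v_def by (rule proj.hom_nat_pow[OF w'])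
  ultimately show ?thesis
    using Q.pow_eq_id[OF proj.hom_closed[OF w'], of m] by simp
qed

section \<open>Cycle counts and convergence\<close>

lemma num_cycles_mult:
  assumes "\<sigma> permutes {1..n}"
  shows "l * num_cycles n l \<sigma> = card {x \<in> {1..n}. card (orbit \<sigma> x) = l}"
proof -
  have perm: "permutation \<sigma>" using assms by (auto simp: permutation_permutes)
  let ?C = "{C \<in> cycle_supports n \<sigma>. card C = l}"
  have union: "\<Union>?C = {x \<in> {1..n}. card (orbit \<sigma> x) = l}"
  proof (intro equalityI subsetI)
    fix x assume "x \<in> \<Union>?C"
    then obtain y where y: "y \<in> {1..n}" "x \<in> orbit \<sigma> y" "card (orbit \<sigma> y) = l"
      by (auto simp: cycle_supports_def)
    then have "orbit \<sigma> x = orbit \<sigma> y"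
      using orbit_cyclic_eq3[OF cyclic_on_orbit'[OF perm]] by metis
    then show "x \<in> {x \<in> {1..n}. card (orbit \<sigma> x) = l}"
      using y permutes_orbit_subset[OF assms y(1)] by auto
  next
    fix x assume "x \<in> {x \<in> {1..n}. card (orbit \<sigma> x) = l}"
    then show "x \<in> \<Union>?C"
      using permutation_self_in_orbit[OF perm, of x] by (auto simp: cycle_supports_def)
  qed
  have disj: "C \<inter> D = {}" if CD: "C \<in> ?C" "D \<in> ?C" "C \<noteq> D" for C D
  proof -
    obtain y z where "C = orbit \<sigma> y" "D = orbit \<sigma> z"
      using CD(1,2) unfolding cycle_supports_def by blast
    then show ?thesis
      using CD(3) orbit_cyclic_eq3[OF cyclic_on_orbit'[OF perm]] by (metis disjoint_iff)
  qed
  have "l * card ?C = card (\<Union>?C)"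
  proof (rule card_partition)
    show "finite ?C" by (simp add: cycle_supports_def)
    show "finite (\<Union>?C)" unfolding union by simp
  qed (use disj in blast)+
  then show ?thesis by (simp only: num_cycles_def union)
qed

context nonempty_cycle_lengths
begin

text \<open>A point is fixed by the m-th power of a permutation exactly if its cycle length divides m. Typical
  points are fixed by the d-th power and by no smaller one.\<close>

lemma negligible_word_cycle_lengths:
  assumes w: "w \<in> words_over k" "reduced_word w" and d: "1 \<le> d"
    and ord: "group.ord (quotient_group k A) (word_class k A w) = d"
  shows "negligible k A (\<lambda>s x. card (orbit (eval_word s w) x) \<noteq> d)"
proof -
  have fixes_iff: "eval_word s (concat (replicate m w)) x = x \<longleftrightarrow> card (orbit (eval_word s w) x) dvd m"
    if "s \<in> perm_tuples k A n" for s n m x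
  proof -
    have "permutation (eval_word s w)"
      using eval_word_permutes[OF that w(1)] by (auto simp: permutation_permutes)
    then show ?thesis
      by (simp add: eval_word_concat_replicate funpow_fixes_iff_card_orbit_dvd)
  qed
  have over: "concat (replicate m w) \<in> words_over k" for m
    using w(1) by (induction m) simp_all
  note iff = word_power_in_relator_subgroup_iff[OF w, of _ A, unfolded ord]
  have "negligible k A (\<lambda>s x. eval_word s (reduce_word (concat (replicate d w))) x \<noteq> x)"
    by (rule negligible_moved_points) (simp add: iff)
  then have 1: "negligible k A (\<lambda>s x. \<not> card (orbit (eval_word s w) x) dvd d)"
    by (rule negligible_mono) (simp add: eval_reduce_word over fixes_iff)
  have "negligible k A (\<lambda>s x. \<exists>m\<in>{1..<d}. eval_word s (concat (replicate m w)) x = x)"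
    by (intro negligible_Bex negligible_fixed_points over) (auto simp: iff dest: dvd_imp_le)
  then have 2: "negligible k A (\<lambda>s x. \<exists>m\<in>{1..<d}. card (orbit (eval_word s w) x) dvd m)"
    by (rule negligible_mono) (simp add: fixes_iff)
  show ?thesis
  proof (rule negligible_mono[OF negligible_disj[OF 1 2]])
    fix n s x
    let ?l = "card (orbit (eval_word s w) x)"
    assume ne: "?l \<noteq> d"
    show "\<not> ?l dvd d \<or> (\<exists>m\<in>{1..<d}. ?l dvd m)"
    proof (cases "?l dvd d")
      case True
      then have "?l \<in> {1..<d}"
        using ne d dvd_imp_le[OF True] by (auto simp: Suc_le_eq intro: Nat.gr0I)
      then show ?thesis by (intro disjI2 bexI[of _ ?l]) auto
    qed simp
  qed
qed

end

text \<open>Multiplied by l, the number of l-cycles becomes a number of points, so it is controlled by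
  the points whose cycle does not have length d.\<close>

lemma num_cycles_deviation:
  assumes \<sigma>: "\<sigma> permutes {1..n}" and n: "0 < n" and l: "1 \<le> l" and d: "1 \<le> d"
  shows "\<bar>real (num_cycles n l \<sigma>) / real n - (if l = d then 1 / real d else 0)\<bar>
    \<le> real (card {x \<in> {1..n}. card (orbit \<sigma> x) \<noteq> d}) / real n"
proof -
  let ?B = "{x \<in> {1..n}. card (orbit \<sigma> x) \<noteq> d}" and ?G = "{x \<in> {1..n}. card (orbit \<sigma> x) = d}"
  note cyc = num_cycles_mult[OF \<sigma>]
  show ?thesis
  proof (cases "l = d")
    case True
    have "card ?G + card ?B = card (?G \<union> ?B)"
      by (intro card_Un_disjoint[symmetric]) auto
    also have "?G \<union> ?B = {1..n}" by auto
    finally have "real d * real (num_cycles n d \<sigma>) + real (card ?B) = real n"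
      using cyc[of d] by (metis card_atLeastAtMost diff_Suc_1 of_nat_add of_nat_mult)
    then have "real d * real (num_cycles n d \<sigma>) - real n = - real (card ?B)" by linarith
    moreover have "real (num_cycles n d \<sigma>) / real n - 1 / real d
        = (real d * real (num_cycles n d \<sigma>) - real n) / (real d * real n)"
      using n d by (simp add: field_simps)
    ultimately have "real (num_cycles n d \<sigma>) / real n - 1 / real d = - (real (card ?B) / (real d * real n))"
      by simp
    also have "\<bar>\<dots>\<bar> = real (card ?B) / (real d * real n)" by simp
    also have "\<dots> \<le> real (card ?B) / real n"
      using n d by (intro divide_left_mono) auto
    finally show ?thesis using True by simp
  next
    case False
    have "num_cycles n l \<sigma> \<le> l * num_cycles n l \<sigma>" using l by simp
    also have "\<dots> \<le> card ?B"
      unfolding cyc using False by (intro card_mono) auto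
    finally show ?thesis using False by (simp add: divide_right_mono)
  qed
qed

lemma distr_tuple_uniform:
  fixes M :: "'a measure" and k :: nat
  assumes "prob_space M" and k: "1 \<le> k"
    and R: "\<And>i. i \<in> {1..k} \<Longrightarrow> finite (R i) \<and> R i \<noteq> {}"
    and uniform: "\<And>i. i \<in> {1..k} \<Longrightarrow> distr M (count_space (R i)) (X i) = uniform_count_measure (R i)"
    and indep: "prob_space.indep_vars M (\<lambda>i. count_space (R i)) X {1..k}"
  shows "(\<lambda>\<omega>. \<lambda>i\<in>{1..k}. X i \<omega>) \<in> measurable M (count_space (PiE {1..k} R))"
    and "distr M (count_space (PiE {1..k} R)) (\<lambda>\<omega>. \<lambda>i\<in>{1..k}. X i \<omega>) = uniform_count_measure (PiE {1..k} R)"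
proof -
  interpret prob_space M by fact
  let ?Y = "\<lambda>\<omega>. \<lambda>i\<in>{1..k}. X i \<omega>"
  have fin: "finite (PiE {1..k} R)" using R by (intro finite_PiE) auto
  have meas: "X i \<in> measurable M (count_space (R i))" if "i \<in> {1..k}" for i
    using indep that by (auto simp: indep_vars_def)
  have vimage: "?Y -` {f} \<inter> space M = (\<Inter>i\<in>{1..k}. X i -` {f i} \<inter> space M)" if "f \<in> PiE {1..k} R" for f
  proof (intro equalityI subsetI)
    fix \<omega> assume "\<omega> \<in> (\<Inter>i\<in>{1..k}. X i -` {f i} \<inter> space M)"
    then have "X i \<omega> = f i" "\<omega> \<in> space M" if "i \<in> {1..k}" for i using that by auto
    then show "\<omega> \<in> ?Y -` {f} \<inter> space M"
      using \<open>f \<in> PiE {1..k} R\<close> k by (auto simp: PiE_iff extensional_def fun_eq_iff)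
  qed auto
  have single: "X i -` {f i} \<inter> space M \<in> sets M" if "i \<in> {1..k}" "f \<in> PiE {1..k} R" for i f
    using measurable_sets[OF meas[OF that(1)]] that by (auto simp: PiE_iff)
  show Y: "?Y \<in> measurable M (count_space (PiE {1..k} R))"
    unfolding measurable_count_space_eq2[OF fin]
  proof (intro conjI ballI)
    show "?Y \<in> space M \<rightarrow> PiE {1..k} R"
      using measurable_space[OF meas] by (auto simp: PiE_iff)
    fix f assume f: "f \<in> PiE {1..k} R"
    show "?Y -` {f} \<inter> space M \<in> sets M"
      unfolding vimage[OF f] using k single[OF _ f] by (intro sets.finite_INT) auto
  qed
  show "distr M (count_space (PiE {1..k} R)) ?Y = uniform_count_measure (PiE {1..k} R)"
  proof (rule measure_eqI_finite[OF _ _ fin])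
    fix f assume f: "f \<in> PiE {1..k} R"
    have "prob (?Y -` {f} \<inter> space M) = (\<Prod>i\<in>{1..k}. prob (X i -` {f i} \<inter> space M))"
      unfolding vimage[OF f] using k f by (intro indep_varsD_finite[OF indep]) (auto simp: PiE_iff)
    also have "\<dots> = (\<Prod>i\<in>{1..k}. 1 / real (card (R i)))"
    proof (intro prod.cong refl)
      fix i assume i: "i \<in> {1..k}"
      have "prob (X i -` {f i} \<inter> space M) = measure (distr M (count_space (R i)) (X i)) {f i}"
        using meas[OF i] f i by (intro measure_distr[symmetric]) (auto simp: PiE_iff)
      also have "\<dots> = 1 / real (card (R i))"
        using uniform[OF i] R[OF i] f i by (simp add: measure_uniform_count_measure PiE_iff)
      finally show "prob (X i -` {f i} \<inter> space M) = 1 / real (card (R i))" .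
    qed
    also have "\<dots> = 1 / real (card (PiE {1..k} R))"
      by (simp add: card_PiE prod_dividef)
    finally have "emeasure M (?Y -` {f} \<inter> space M) = ennreal (1 / real (card (PiE {1..k} R)))"
      by (simp add: emeasure_eq_measure)
    then show "emeasure (distr M (count_space (PiE {1..k} R)) ?Y) {f} = emeasure (uniform_count_measure (PiE {1..k} R)) {f}"
      using Y f fin by (simp add: emeasure_distr emeasure_uniform_count_measure)
  qed (simp_all add: sets_uniform_count_measure)
qed

lemma eval_word_restrict:
  assumes "w \<in> words_over k"
  shows "eval_word (\<lambda>i\<in>{1..k}. s i) w = eval_word s w"
  using assms by (induction w) (auto simp: eval_letter_def)

text \<open>The deviation from c is at most 1, so its p-th power is at most the deviation itself, whose mean
  over the uniform tuples is bounded by the mean proportion of exceptional points.\<close>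

lemma converges_in_Lp_if_negligible:
  fixes M :: "nat \<Rightarrow> 'a measure" and X :: "nat \<Rightarrow> (nat \<Rightarrow> nat \<Rightarrow> nat) \<Rightarrow> real"
  assumes k: "1 \<le> k"
    and prob: "\<And>n. n \<in> admissible k A \<Longrightarrow> prob_space (M n)"
    and uniform: "\<And>n i. n \<in> admissible k A \<Longrightarrow> i \<in> {1..k} \<Longrightarrow>
           distr (M n) (count_space (restricted_perms n (A i))) (s i n)
             = uniform_count_measure (restricted_perms n (A i))"
    and indep: "\<And>n. n \<in> admissible k A \<Longrightarrow>
           prob_space.indep_vars (M n) (\<lambda>i. count_space (restricted_perms n (A i)))
             (\<lambda>i. s i n) {1..k}"
    and restrict: "\<And>n t. X n (\<lambda>i\<in>{1..k}. t i) = X n t"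
    and D: "negligible k A D"
    and bound: "\<And>n t. 0 < n \<Longrightarrow> t \<in> perm_tuples k A n \<Longrightarrow> \<bar>X n t - c\<bar> \<le> real (card {x \<in> {1..n}. D t x}) / real n"
    and p: "1 \<le> p"
  shows "converges_in_Lp p M (\<lambda>n \<omega>. X n (\<lambda>i. s i n \<omega>)) c (admissible_filter k A)"
proof -
  define Y where "Y = (\<lambda>n \<omega>. \<lambda>i\<in>{1..k}. s i n \<omega>)"
  have X: "X n (\<lambda>i. s i n \<omega>) = X n (Y n \<omega>)" for n \<omega>
    by (simp only: Y_def restrict)
  have Y: "Y n \<in> measurable (M n) (count_space (perm_tuples k A n))"
    and distr: "distr (M n) (count_space (perm_tuples k A n)) (Y n) = uniform_count_measure (perm_tuples k A n)"
    if n: "n \<in> admissible k A" for n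
    using distr_tuple_uniform[OF prob[OF n] k _ uniform[OF n] indep[OF n]] n
    unfolding perm_tuples_def Y_def by (auto simp: admissible_def)
  have meas: "(\<lambda>\<omega>. h (Y n \<omega>)) \<in> borel_measurable (M n)" 
    and int: "integrable (M n) (\<lambda>\<omega>. h (Y n \<omega>))"
    and expect: "(\<integral>\<omega>. h (Y n \<omega>) \<partial>M n) = (\<Sum>t\<in>perm_tuples k A n. h t) / real (card (perm_tuples k A n))"
    if n: "n \<in> admissible k A" for n and h :: "(nat \<Rightarrow> nat \<Rightarrow> nat) \<Rightarrow> real"
  proof -
    have h: "h \<in> borel_measurable (count_space (perm_tuples k A n))" by simp
    show "(\<lambda>\<omega>. h (Y n \<omega>)) \<in> borel_measurable (M n)"
      by (rule measurable_compose[OF Y[OF n] h])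
    show "integrable (M n) (\<lambda>\<omega>. h (Y n \<omega>))"
      unfolding integrable_distr_eq[OF Y[OF n] h, symmetric] distr[OF n] uniform_count_measure_def
      by (intro integrable_point_measure_finite) simp
    show "(\<integral>\<omega>. h (Y n \<omega>) \<partial>M n) = (\<Sum>t\<in>perm_tuples k A n. h t) / real (card (perm_tuples k A n))"
      unfolding integral_distr[OF Y[OF n] h, symmetric] distr[OF n]
      by (rule integral_uniform_count_measure) simp
  qed
  have adm: "eventually P (admissible_filter k A) \<longleftrightarrow> (\<forall>\<^sub>F n in sequentially. n \<in> admissible k A \<longrightarrow> P n)" for P
    by (simp add: admissible_filter_def eventually_inf_principal)
  have "((\<lambda>n. \<integral>\<omega>. \<bar>X n (Y n \<omega>) - c\<bar> powr p \<partial>M n) \<longlongrightarrow> 0) (admissible_filter k A)"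
  proof (rule tendstoI)
    fix \<epsilon> :: real assume \<epsilon>: "0 < \<epsilon>"
    have "\<forall>\<^sub>F n in sequentially. (\<Sum>t\<in>perm_tuples k A n. real (card {x \<in> {1..n}. D t x}))
        \<le> \<epsilon> / 2 * real n * real (card (perm_tuples k A n))"
      by (rule D[unfolded negligible_def, rule_format]) (use \<epsilon> in simp)
    then show "\<forall>\<^sub>F n in admissible_filter k A. dist (\<integral>\<omega>. \<bar>X n (Y n \<omega>) - c\<bar> powr p \<partial>M n) 0 < \<epsilon>"
      unfolding adm using eventually_gt_at_top[of 0]
    proof eventually_elim
      case (elim n)
      show ?case
      proof
        assume n: "n \<in> admissible k A"
        let ?T = "perm_tuples k A n"
        have "?T \<noteq> {}" using n by (auto simp: perm_tuples_def PiE_eq_empty_iff admissible_def)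
        then have card: "0 < card ?T" by (simp add: card_gt_0_iff)
        have "\<bar>X n t - c\<bar> powr p \<le> real (card {x \<in> {1..n}. D t x}) / real n" if "t \<in> ?T" for t
        proof -
          have "card {x \<in> {1..n}. D t x} \<le> card {1..n}" by (intro card_mono) auto
          then have "real (card {x \<in> {1..n}. D t x}) / real n \<le> 1"
            using elim(2) by simp
          with bound[OF elim(2) that] have "\<bar>X n t - c\<bar> \<le> 1" by linarith
          then have "\<bar>X n t - c\<bar> powr p \<le> \<bar>X n t - c\<bar> powr 1"
            using p by (intro powr_mono') auto
          then show ?thesis using bound[OF elim(2) that] by simp
        qed
        then have "(\<Sum>t\<in>?T. \<bar>X n t - c\<bar> powr p) \<le> (\<Sum>t\<in>?T. real (card {x \<in> {1..n}. D t x}) / real n)"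
          by (rule sum_mono)
        also have "\<dots> = (\<Sum>t\<in>?T. real (card {x \<in> {1..n}. D t x})) / real n"
          by (simp add: sum_divide_distrib)
        also have "\<dots> \<le> (\<epsilon> / 2 * real n * real (card ?T)) / real n"
          by (intro divide_right_mono elim(1)) simp
        also have "\<dots> = \<epsilon> / 2 * real (card ?T)" using elim(2) by simp
        also have "\<dots> < \<epsilon> * real (card ?T)" using \<epsilon> card by simp
        finally have "(\<Sum>t\<in>?T. \<bar>X n t - c\<bar> powr p) / real (card ?T) < \<epsilon>"
          using card by (simp add: divide_less_eq)
        moreover have "0 \<le> (\<Sum>t\<in>?T. \<bar>X n t - c\<bar> powr p) / real (card ?T)"
          by (intro divide_nonneg_nonneg sum_nonneg) auto
        ultimately show "dist (\<integral>\<omega>. \<bar>X n (Y n \<omega>) - c\<bar> powr p \<partial>M n) 0 < \<epsilon>"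
          using expect[OF n, of "\<lambda>t. \<bar>X n t - c\<bar> powr p"] by (simp add: dist_real_def)
      qed
    qed
  qed
  moreover have "\<forall>\<^sub>F n in admissible_filter k A. (\<lambda>\<omega>. X n (Y n \<omega>)) \<in> borel_measurable (M n) \<and>
      integrable (M n) (\<lambda>\<omega>. \<bar>X n (Y n \<omega>)\<bar> powr p)"
    unfolding adm
  proof (intro always_eventually allI impI conjI)
    fix n assume n: "n \<in> admissible k A"
    show "(\<lambda>\<omega>. X n (Y n \<omega>)) \<in> borel_measurable (M n)" by (rule meas[OF n])
    show "integrable (M n) (\<lambda>\<omega>. \<bar>X n (Y n \<omega>)\<bar> powr p)" by (rule int[OF n])
  qed
  ultimately show ?thesis
    unfolding converges_in_Lp_def X by simp
qed

theorem theorem3p6: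
  fixes k d :: nat
    and A :: "nat \<Rightarrow> nat set"
    and M :: "nat \<Rightarrow> 'a measure"
    and s :: "nat \<Rightarrow> nat \<Rightarrow> 'a \<Rightarrow> (nat \<Rightarrow> nat)"
    and w :: gen_word
  assumes "k \<ge> 1"
    and "\<And>i. i \<in> {1..k} \<Longrightarrow> A i \<noteq> {} \<and> 0 \<notin> A i \<and> A i \<noteq> {1}"
    and "\<And>i. i \<in> {1..k} \<Longrightarrow>
           finite (A i) \<or> (\<lambda>j. 1 / real j) summable_on {j. j \<ge> 1 \<and> j \<notin> A i}"
    and "\<And>n. n \<in> admissible k A \<Longrightarrow> prob_space (M n)"
    and "\<And>n i. n \<in> admissible k A \<Longrightarrow> i \<in> {1..k} \<Longrightarrow>
           distr (M n) (count_space (restricted_perms n (A i))) (s i n)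
             = uniform_count_measure (restricted_perms n (A i))"
    and "\<And>n. n \<in> admissible k A \<Longrightarrow>
           prob_space.indep_vars (M n) (\<lambda>i. count_space (restricted_perms n (A i)))
             (\<lambda>i. s i n) {1..k}"
    and "w \<in> words_over k"
    and "cyclically_reduced w"
    and "d \<ge> 1"
    and "group.ord (quotient_group k A) (word_class k A w) = d"
  shows "\<forall>p\<ge>1. converges_in_Lp p M
             (\<lambda>n \<omega>. real (num_cycles n d (eval_word (\<lambda>i. s i n \<omega>) w)) / real n) (1 / real d)
             (admissible_filter k A) \<and>
           (\<forall>l\<ge>1. l \<noteq> d \<longrightarrow> converges_in_Lp p M
             (\<lambda>n \<omega>. real (num_cycles n l (eval_word (\<lambda>i. s i n \<omega>) w)) / real n) 0
             (admissible_filter k A))"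
proof (intro allI impI conjI)
  fix p :: real assume p: "1 \<le> p"
  interpret nonempty_cycle_lengths k A by unfold_locales (use assms(2) in blast)
  have over: "w \<in> words_over k" and red: "reduced_word w"
    using assms(7,8) by (auto simp: cyclically_reduced_def)
  have conv: "converges_in_Lp p M
      (\<lambda>n \<omega>. real (num_cycles n l (eval_word (\<lambda>i. s i n \<omega>) w)) / real n)
      (if l = d then 1 / real d else 0) (admissible_filter k A)" if l: "1 \<le> l" for l
  proof (rule converges_in_Lp_if_negligible[OF assms(1,4-6) _ negligible_word_cycle_lengths[OF over red assms(9,10)] _ p])
    show "real (num_cycles n l (eval_word (\<lambda>i\<in>{1..k}. t i) w)) / real n = real (num_cycles n l (eval_word t w)) / real n" for n t
      by (simp only: eval_word_restrict[OF over])
    show "\<bar>real (num_cycles n l (eval_word t w)) / real n - (if l = d then 1 / real d else 0)\<bar>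
        \<le> real (card {x \<in> {1..n}. card (orbit (eval_word t w) x) \<noteq> d}) / real n"
      if "0 < n" "t \<in> perm_tuples k A n" for n t
      by (rule num_cycles_deviation[OF eval_word_permutes[OF that(2) over] that(1) l assms(9)])
  qed
  show "converges_in_Lp p M (\<lambda>n \<omega>. real (num_cycles n d (eval_word (\<lambda>i. s i n \<omega>) w)) / real n) (1 / real d)
      (admissible_filter k A)"
    using conv[OF assms(9)] by simp
  show "converges_in_Lp p M (\<lambda>n \<omega>. real (num_cycles n l (eval_word (\<lambda>i. s i n \<omega>) w)) / real n) 0
      (admissible_filter k A)" if "1 \<le> l" "l \<noteq> d" for l
    using conv[OF that(1)] that(2) by simp
qed

end
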